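(* Let $\Bbbk$ be a field of characteristic zero and let $m\ge 3$ be an integer. Then the artinian algebra $A(T_{m,2})$ has the weak Lefschetz property if and only if $m\in\{4,5,7,8,11\}$.
   Context: For integers $m\ge 3$, $n\ge 1$, the tadpole graph $T_{m,n}$ is the simple graph with vertex set $\{x_1,\dots,x_m,y_1,\dots,y_n\}$ and edges $\{x_i,x_{i+1}\}$ for $1\le i\le m-1$, $\{x_m,x_1\}$ (so the $x_i$ form an $m$-cycle), $\{y_j,y_{j+1}\}$ for $1\le j\le n-1$ (so the $y_j$ form a path), and the bridge $\{x_m,y_1\}$. For a simple graph $G$ on vertices $1,\dots,N$, let $R=\Bbbk[x_1,\dots,x_N]$ be the standard graded polynomial ring, $I(G)=(x_ix_j : \{i,j\}\text{ an edge of }G)$ its edge ideal, and $A(G)=R/\big((x_1^2,\dots,x_N^2)+I(G)\big)$, a standard graded artinian algebra $A=\bigoplus_{j=0}^s [A]_j$. Such an $A$ has the weak Lefschetz property (WLP) if there is a linear form $\ell\in[A]_1$ such that multiplication $\times\ell:[A]_j\to[A]_{j+1}$ is injective or surjective for every $j=0,\dots,s-1$. *)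

theory Defs
  imports "HOL-Library.Poly_Mapping"
begin

text \<open>Polynomials over a field 'k in the variables x_1, x_2, ... are represented as
  finitely supported maps from monomials (finitely supported exponent vectors) to coefficients.
  The polynomial ring R = k[x_1,...,x_N] is the set of polynomials only involving the
  variables with indices in {1..N}.\<close>

type_synonym 'k mpoly = "(nat \<Rightarrow>\<^sub>0 nat) \<Rightarrow>\<^sub>0 'k"

definition var :: "nat \<Rightarrow> 'k::comm_ring_1 mpoly" where
  "var i = Poly_Mapping.single (Poly_Mapping.single i 1) 1"

definition polys :: "nat \<Rightarrow> 'k::comm_ring_1 mpoly set" where
  "polys N = {f :: 'k mpoly. \<forall>\<alpha>\<in>Poly_Mapping.keys f. Poly_Mapping.keys \<alpha> \<subseteq> {1..N}}"

definition mon_deg :: "(nat \<Rightarrow>\<^sub>0 nat) \<Rightarrow> nat" where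
  "mon_deg \<alpha> = (\<Sum>i\<in>Poly_Mapping.keys \<alpha>. Poly_Mapping.lookup \<alpha> i)"

definition homog :: "nat \<Rightarrow> 'k::comm_ring_1 mpoly \<Rightarrow> bool" where
  "homog j f \<longleftrightarrow> (\<forall>\<alpha>\<in>Poly_Mapping.keys f. mon_deg \<alpha> = j)"

inductive_set ideal_gen :: "nat \<Rightarrow> 'k::comm_ring_1 mpoly set \<Rightarrow> 'k mpoly set"
  for N S where
  zero: "0 \<in> ideal_gen N S"
| step: "g \<in> S \<Longrightarrow> h \<in> polys N \<Longrightarrow> f \<in> ideal_gen N S \<Longrightarrow> h * g + f \<in> ideal_gen N S"

text \<open>Simple graph on vertices 1..N given by a set E of 2-element edges {i,j}.
  The defining ideal (x_1^2,...,x_N^2) + I(G) of A(G).\<close>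
definition AG_gens :: "nat \<Rightarrow> nat set set \<Rightarrow> 'k::comm_ring_1 mpoly set" where
  "AG_gens N E = {var i * var i | i. i \<in> {1..N}} \<union> {var i * var j | i j. {i, j} \<in> E}"

definition AG_ideal :: "'k::comm_ring_1 itself \<Rightarrow> nat \<Rightarrow> nat set set \<Rightarrow> 'k mpoly set" where
  "AG_ideal _ N E = ideal_gen N (AG_gens N E)"

definition AG_top_degree :: "'k::comm_ring_1 itself \<Rightarrow> nat \<Rightarrow> nat set set \<Rightarrow> nat" where
  "AG_top_degree K N E =
     (GREATEST j. \<exists>f::'k mpoly. f \<in> polys N \<and> homog j f \<and> f \<notin> AG_ideal K N E)"

text \<open>Multiplication by the class of l from [A]_j to [A]_{j+1} is injective / surjective,
  where [A]_j = [R]_j / (I \<inter> [R]_j).\<close>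
definition mult_inj :: "'k::comm_ring_1 itself \<Rightarrow> nat \<Rightarrow> nat set set \<Rightarrow> 'k mpoly \<Rightarrow> nat \<Rightarrow> bool" where
  "mult_inj K N E l j \<longleftrightarrow>
     (\<forall>f. f \<in> polys N \<and> homog j f \<and> l * f \<in> AG_ideal K N E \<longrightarrow> f \<in> AG_ideal K N E)"

definition mult_surj :: "'k::comm_ring_1 itself \<Rightarrow> nat \<Rightarrow> nat set set \<Rightarrow> 'k mpoly \<Rightarrow> nat \<Rightarrow> bool" where
  "mult_surj K N E l j \<longleftrightarrow>
     (\<forall>g. g \<in> polys N \<and> homog (Suc j) g \<longrightarrow>
        (\<exists>f. f \<in> polys N \<and> homog j f \<and> g - l * f \<in> AG_ideal K N E))"

definition AG_has_WLP :: "'k::comm_ring_1 itself \<Rightarrow> nat \<Rightarrow> nat set set \<Rightarrow> bool" where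
  "AG_has_WLP K N E \<longleftrightarrow>
     (\<exists>c :: nat \<Rightarrow> 'k. let l = (\<Sum>i\<in>{1..N}. Poly_Mapping.single 0 (c i) * var i) in
        \<forall>j < AG_top_degree K N E. mult_inj K N E l j \<or> mult_surj K N E l j)"

text \<open>Tadpole graph T_{m,n}: x_i is vertex i (1 \<le> i \<le> m), y_j is vertex m + j (1 \<le> j \<le> n).\<close>
definition tadpole_edges :: "nat \<Rightarrow> nat \<Rightarrow> nat set set" where
  "tadpole_edges m n =
     {{i, i + 1} | i. 1 \<le> i \<and> i \<le> m - 1} \<union> {{m, 1}}
     \<union> {{m + j, m + j + 1} | j. 1 \<le> j \<and> j \<le> n - 1} \<union> {{m, m + 1}}"

end

theory Submission
  imports Defs
begin

text \<open>The degree \<open>j\<close> part of \<open>A(G)\<close> has the independent sets of size \<open>j\<close> as a basis.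

  Failure: for every linear form, an induced matching of size \<open>k\<close> gives a nonzero functional on
  \<open>[A]\<^sub>k\<close> that kills the image of \<open>[A]\<^sub>k\<^sub>-\<^sub>1\<close> (the tensor product of the functionals of its edges),
  and \<open>T\<^bsub>m,2\<^esub>\<close> has an induced matching of size \<open>k = m div 3 + 1\<close>. For the excluded \<open>m\<close> other
  than 14, \<open>[A]\<^sub>k\<close> is at most as large as \<open>[A]\<^sub>k\<^sub>-\<^sub>1\<close>, so the map is not injective either.

  Success: take the sum of the variables. The sequence
  \<open>0 \<rightarrow> A(G - N[v])(-1) \<rightarrow> A(G) \<rightarrow> A(G - v) \<rightarrow> 0\<close> commutes with the multiplication
  maps, so injectivity and surjectivity pass from the ends to the middle. Removing vertices in a
  suitable order reduces everything to edgeless graphs on 3 or 5 vertices, except that for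
  \<open>m = 7, 11\<close> the top injectivity leads to \<open>C\<^sub>m\<close> plus an isolated vertex; there it amounts to the
  injectivity of the square of the linear form on \<open>A(C\<^sub>m)\<close>.\<close>

section \<open>Multiplication by a linear form in the basis of independent sets\<close>

text \<open>The condition is also tested at \<open>u = v\<close>, where it says
  \<open>{u} \<notin> E\<close>; hence the hypotheses below that \<open>E\<close> has no
  loops.\<close>

definition indep_sets :: "'a set set \<Rightarrow> 'a set \<Rightarrow> nat \<Rightarrow> 'a set set" where
  "indep_sets E V k = {S. S \<subseteq> V \<and> finite S \<and> card S = k \<and> (\<forall>u\<in>S. \<forall>v\<in>S. {u, v} \<notin> E)}"

definition indep_set :: "'a set set \<Rightarrow> 'a set \<Rightarrow> bool" where
  "indep_set E V \<longleftrightarrow> (\<forall>u\<in>V. \<forall>v\<in>V. {u, v} \<notin> E)"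

text \<open>For \<open>v \<notin> V\<close> this is the vertex set of G - N[v]: adding
  \<open>v\<close> is a bijection from its independent sets onto the independent sets of
  \<open>insert v V\<close> that contain \<open>v\<close>.\<close>

definition away :: "'a set set \<Rightarrow> 'a \<Rightarrow> 'a set \<Rightarrow> 'a set" where
  "away E v V = {u \<in> V. {u, v} \<notin> E}"

text \<open>The coefficient at the monomial x_T of the product of the linear form with coefficients
  \<open>c\<close> and the element with coefficients \<open>a\<close>; the summand at
  \<open>v\<close> comes from x_v times x_(T - v).\<close>

definition lin_mult :: "('a \<Rightarrow> 'k::comm_ring_1) \<Rightarrow> ('a set \<Rightarrow> 'k) \<Rightarrow> 'a set \<Rightarrow> 'k" where
  "lin_mult c a T = (\<Sum>v\<in>T. c v * a (T - {v}))"

definition inj_at :: "('a \<Rightarrow> 'k::comm_ring_1) \<Rightarrow> 'a set set \<Rightarrow> 'a set \<Rightarrow> nat \<Rightarrow> bool" where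
  "inj_at c E V k \<longleftrightarrow>
     (\<forall>a. (\<forall>T\<in>indep_sets E V (Suc k). lin_mult c a T = 0) \<longrightarrow> (\<forall>S\<in>indep_sets E V k. a S = 0))"

text \<open>Indexed by the target degree, so that nothing is onto in degree 0.\<close>
definition onto_at :: "('a \<Rightarrow> 'k::comm_ring_1) \<Rightarrow> 'a set set \<Rightarrow> 'a set \<Rightarrow> nat \<Rightarrow> bool" where
  "onto_at c E V k \<longleftrightarrow> (\<forall>b. \<exists>a. \<forall>T\<in>indep_sets E V k. lin_mult c a T = b T)"

lemma indep_setD: "indep_set E V \<Longrightarrow> u \<in> V \<Longrightarrow> v \<in> V \<Longrightarrow> {u, v} \<notin> E"
  by (simp add: indep_set_def)

lemma indep_set_loopless: "indep_set E V \<Longrightarrow> v \<in> V \<Longrightarrow> {v} \<notin> E"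
  using indep_setD[of E V v v] by simp

lemma indep_set_subset: "indep_set E V \<Longrightarrow> W \<subseteq> V \<Longrightarrow> indep_set E W"
  by (auto simp: indep_set_def)

lemma away_indep_set: "indep_set E V \<Longrightarrow> v \<in> V \<Longrightarrow> W \<subseteq> V \<Longrightarrow> away E v W = W"
  unfolding away_def using indep_setD by fastforce

lemma indep_sets_0 [simp]: "indep_sets E V 0 = {{}}"
  by (auto simp: indep_sets_def)

lemma indep_sets_empty [simp]: "indep_sets E {} (Suc k) = {}"
  by (auto simp: indep_sets_def)

lemma finite_indep_sets [simp]: "finite V \<Longrightarrow> finite (indep_sets E V k)"
  by (rule finite_subset[of _ "Pow V"]) (auto simp: indep_sets_def)

lemma indep_sets_mono: "V \<subseteq> W \<Longrightarrow> S \<in> indep_sets E V k \<Longrightarrow> S \<in> indep_sets E W k"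
  by (auto simp: indep_sets_def)

lemma indep_sets_remove: "T \<in> indep_sets E V (Suc k) \<Longrightarrow> v \<in> T \<Longrightarrow> T - {v} \<in> indep_sets E V k"
  by (auto simp: indep_sets_def)

lemma indep_sets_notin: "T \<in> indep_sets E (insert v V) k \<Longrightarrow> v \<notin> T \<Longrightarrow> T \<in> indep_sets E V k"
  by (auto simp: indep_sets_def)

lemma indep_sets_insert:
  assumes "S \<in> indep_sets E (away E v V) k" "v \<notin> V" "{v} \<notin> E"
  shows "insert v S \<in> indep_sets E (insert v V) (Suc k)"
proof -
  have "v \<notin> S" using assms by (auto simp: indep_sets_def away_def)
  then show ?thesis using assms by (auto simp: indep_sets_def away_def insert_commute)
qed

lemma indep_sets_link:
  assumes "T \<in> indep_sets E (insert v V) (Suc k)" "v \<in> T"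
  shows "T - {v} \<in> indep_sets E (away E v V) k"
  using assms by (auto simp: indep_sets_def away_def)

lemma indep_sets_away: "S \<in> indep_sets E (away E v V) k \<Longrightarrow> S \<in> indep_sets E V k"
  by (auto simp: indep_sets_def away_def)

lemma indep_sets_split:
  assumes "v \<notin> V" "{v} \<notin> E"
  shows "indep_sets E (insert v V) (Suc k)
    = indep_sets E V (Suc k) \<union> insert v ` indep_sets E (away E v V) k"
proof (intro equalityI subsetI)
  fix T assume T: "T \<in> indep_sets E (insert v V) (Suc k)"
  show "T \<in> indep_sets E V (Suc k) \<union> insert v ` indep_sets E (away E v V) k"
  proof (cases "v \<in> T")
    case True
    then have "T = insert v (T - {v})" by auto
    then show ?thesis using indep_sets_link[OF T True] by blast
  next
    case False
    then show ?thesis using indep_sets_notin[OF T] by blast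
  qed
next
  fix T assume "T \<in> indep_sets E V (Suc k) \<union> insert v ` indep_sets E (away E v V) k"
  then show "T \<in> indep_sets E (insert v V) (Suc k)"
    using indep_sets_insert[OF _ assms] indep_sets_mono[of V "insert v V"] by blast
qed

lemma card_indep_sets_insert:
  assumes "finite V" "v \<notin> V" "{v} \<notin> E"
  shows "card (indep_sets E (insert v V) (Suc k))
    = card (indep_sets E V (Suc k)) + card (indep_sets E (away E v V) k)"
proof -
  have notin: "v \<notin> S" if "S \<in> indep_sets E (away E v V) k" for S
    using that assms by (auto simp: indep_sets_def away_def)
  have "inj_on (insert v) (indep_sets E (away E v V) k)"
    by (rule inj_onI) (metis notin insert_ident)
  moreover have "finite (away E v V)" using assms by (simp add: away_def)
  moreover have "indep_sets E V (Suc k) \<inter> insert v ` indep_sets E (away E v V) k = {}"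
    using assms by (auto simp: indep_sets_def)
  ultimately show ?thesis
    using assms by (simp add: indep_sets_split card_Un_disjoint card_image)
qed

lemma card_indep_sets_insert_isolated:
  assumes "finite V" "v \<notin> V" "{v} \<notin> E" "\<And>u. u \<in> V \<Longrightarrow> {u, v} \<notin> E"
  shows "card (indep_sets E (insert v V) (Suc k)) = card (indep_sets E V (Suc k)) + card (indep_sets E V k)"
proof -
  have "away E v V = V" using assms(4) by (auto simp: away_def)
  then show ?thesis using card_indep_sets_insert[OF assms(1-3), of k] by simp
qed

lemma lin_mult_insert:
  assumes "finite T" "v \<notin> T"
  shows "lin_mult c a (insert v T) = c v * a T + lin_mult c (\<lambda>S. a (insert v S)) T"
proof -
  have "insert v T - {u} = insert v (T - {u})" if "u \<in> T" for u
    using that assms by auto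
  then show ?thesis using assms by (simp add: lin_mult_def)
qed

lemma lin_mult_cong:
  "(\<And>v. v \<in> T \<Longrightarrow> a (T - {v}) = b (T - {v})) \<Longrightarrow> lin_mult c a T = lin_mult c b T"
  by (simp add: lin_mult_def)

lemma lin_mult_zero: "(\<And>v. v \<in> T \<Longrightarrow> a (T - {v}) = 0) \<Longrightarrow> lin_mult c a T = 0"
  by (simp add: lin_mult_def)

lemma lin_mult_linear:
  "lin_mult c (\<lambda>S. x S + t * y S) T = lin_mult c x T + t * lin_mult c y T"
  by (simp add: lin_mult_def sum.distrib sum_distrib_left algebra_simps)

text \<open>The injective half of the four lemma for 0 -> A(G - N[v])(-1) -> A(G) -> A(G - v) -> 0.
  The coefficients at sets without \<open>v\<close> vanish first; the remaining ones then form a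
  kernel element on G - N[v], one degree lower.\<close>

lemma inj_at_insert:
  assumes "v \<notin> V" "{v} \<notin> E"
    and V: "inj_at c E V (Suc k)" and link: "inj_at c E (away E v V) k"
  shows "inj_at c E (insert v V) (Suc k)"
  unfolding inj_at_def
proof (intro allI impI ballI)
  fix a S
  assume ker: "\<forall>T\<in>indep_sets E (insert v V) (Suc (Suc k)). lin_mult c a T = 0"
    and S: "S \<in> indep_sets E (insert v V) (Suc k)"
  have "\<forall>T\<in>indep_sets E V (Suc (Suc k)). lin_mult c a T = 0"
    using ker indep_sets_mono[of V "insert v V"] by blast
  then have a0: "\<forall>S\<in>indep_sets E V (Suc k). a S = 0"
    using V by (auto simp: inj_at_def)
  have "lin_mult c (\<lambda>S. a (insert v S)) T = 0" if T: "T \<in> indep_sets E (away E v V) (Suc k)" for T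
  proof -
    have "finite T" "v \<notin> T" using T assms(1) by (auto simp: indep_sets_def away_def)
    then have "lin_mult c a (insert v T) = c v * a T + lin_mult c (\<lambda>S. a (insert v S)) T"
      by (rule lin_mult_insert)
    moreover have "lin_mult c a (insert v T) = 0"
      using ker indep_sets_insert[OF T assms(1,2)] by blast
    ultimately show ?thesis using a0 indep_sets_away[OF T] by simp
  qed
  then have a1: "\<forall>S\<in>indep_sets E (away E v V) k. a (insert v S) = 0"
    using link by (auto simp: inj_at_def)
  show "a S = 0"
    using S[unfolded indep_sets_split[OF assms(1,2)]] a0 a1 by blast
qed

text \<open>The surjective half of the four lemma for the same sequence: a preimage is first found
  on G - v and then extended to the sets containing \<open>v\<close>.\<close>

lemma onto_at_insert:
  assumes "v \<notin> V" "{v} \<notin> E"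
    and V: "onto_at c E V (Suc k)" and link: "onto_at c E (away E v V) k"
  shows "onto_at c E (insert v V) (Suc k)"
  unfolding onto_at_def
proof
  fix b
  obtain a0 where a0: "\<forall>T\<in>indep_sets E V (Suc k). lin_mult c a0 T = b T"
    using V unfolding onto_at_def by blast
  \<comment> \<open>The subtracted term is what \<open>a0\<close> already contributes at
    \<open>insert v T\<close>, through removal of \<open>v\<close>.\<close>
  obtain a1 where a1: "\<forall>T\<in>indep_sets E (away E v V) k. lin_mult c a1 T = b (insert v T) - c v * a0 T"
    using link[unfolded onto_at_def, rule_format, of "\<lambda>T. b (insert v T) - c v * a0 T"] by blast
  define a where "a = (\<lambda>S. if v \<in> S then a1 (S - {v}) else a0 S)"
  have "lin_mult c a T = b T" if T: "T \<in> indep_sets E V (Suc k)" for T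
  proof -
    have "v \<notin> T" using T assms(1) by (auto simp: indep_sets_def)
    then have "lin_mult c a T = lin_mult c a0 T" by (intro lin_mult_cong) (simp add: a_def)
    then show ?thesis using a0 T by simp
  qed
  moreover have "lin_mult c a (insert v T) = b (insert v T)" if T: "T \<in> indep_sets E (away E v V) k" for T
  proof -
    have T': "finite T" "v \<notin> T" using T assms(1) by (auto simp: indep_sets_def away_def)
    have "lin_mult c a (insert v T) = c v * a0 T + lin_mult c (\<lambda>S. a (insert v S)) T"
      using T' by (simp add: lin_mult_insert a_def)
    also have "lin_mult c (\<lambda>S. a (insert v S)) T = lin_mult c a1 T"
      using T' by (intro lin_mult_cong) (simp add: a_def)
    finally show ?thesis using a1 T by simp
  qed
  ultimately show "\<exists>a. \<forall>T\<in>indep_sets E (insert v V) (Suc k). lin_mult c a T = b T"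
    unfolding indep_sets_split[OF assms(1,2)] by blast
qed

lemma not_onto_at_0: "\<not> onto_at c E V 0"
  by (auto simp: onto_at_def lin_mult_def intro!: exI[of _ "\<lambda>_. 1"])

lemma onto_at_empty: "onto_at c E {} (Suc k)"
  by (simp add: onto_at_def)

lemma inj_at_0:
  assumes "v \<in> V" "{v} \<notin> E" "c v = 1"
  shows "inj_at c E V 0"
  unfolding inj_at_def
proof (intro allI impI)
  fix a assume "\<forall>T\<in>indep_sets E V (Suc 0). lin_mult c a T = 0"
  moreover have "{v} \<in> indep_sets E V (Suc 0)" using assms by (auto simp: indep_sets_def)
  ultimately have "lin_mult c a {v} = 0" by blast
  then show "\<forall>S\<in>indep_sets E V 0. a S = 0" using assms by (simp add: lin_mult_def)
qed

section \<open>Dimension counts by underdetermined linear systems\<close>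

text \<open>Induction on the number of equations: omitting one unknown at a time yields two
  independent solutions of all equations but one, and some combination of them solves the last. The
  equations are abstract functionals, so that they can be indexed by any type, in particular by a
  disjoint sum.\<close>

lemma homogeneous_system_solution:
  fixes L :: "'j \<Rightarrow> ('i \<Rightarrow> 'k::field) \<Rightarrow> 'k"
  assumes "finite B" "finite A" "card B < card A"
    and lin: "\<And>j x y t. j \<in> B \<Longrightarrow> L j (\<lambda>i. x i + t * y i) = L j x + t * L j y"
  shows "\<exists>x. (\<forall>i. i \<notin> A \<longrightarrow> x i = 0) \<and> (\<exists>i\<in>A. x i \<noteq> 0) \<and> (\<forall>j\<in>B. L j x = 0)"
  using assms
proof (induction B arbitrary: A rule: finite_induct)
  case empty
  then obtain p where "p \<in> A" by fastforce
  then show ?case by (intro exI[of _ "\<lambda>i. if i = p then 1 else 0"]) auto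
next
  case (insert j B)
  have IH: "\<exists>x. (\<forall>i. i \<notin> A - {p} \<longrightarrow> x i = 0) \<and> (\<exists>i\<in>A - {p}. x i \<noteq> 0) \<and> (\<forall>j\<in>B. L j x = 0)"
    if "p \<in> A" for p
    using insert that by (intro insert.IH) auto
  obtain p where "p \<in> A" using insert.prems by fastforce
  then obtain x q where x: "\<forall>i. i \<notin> A \<longrightarrow> x i = 0" "q \<in> A" "x q \<noteq> 0" "\<forall>j\<in>B. L j x = 0"
    using IH[of p] by blast
  \<comment> \<open>Omitting the unknown \<open>q\<close> forces \<open>y q = 0\<close>, so
    \<open>y\<close> is independent of \<open>x\<close>. The combination below is therefore nonzero:
    at \<open>q\<close> if \<open>t \<noteq> 0\<close>, at \<open>r\<close> otherwise.\<close>
  obtain y r where y: "\<forall>i. i \<notin> A \<longrightarrow> y i = 0" "y q = 0" "r \<in> A" "y r \<noteq> 0" "\<forall>j\<in>B. L j y = 0"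
    using IH[of q] x(2) by blast
  show ?case
  proof (cases "L j x = 0")
    case True
    then show ?thesis using x by (intro exI[of _ x]) auto
  next
    case False
    define t where "t = - L j y / L j x"
    let ?z = "\<lambda>i. y i + t * x i"
    have "L j ?z = 0" using insert.prems(3)[of j y t x] False by (simp add: t_def)
    moreover have "L j' ?z = 0" if "j' \<in> B" for j'
      using insert.prems(3)[of j' y t x] x(4) y(5) that by simp
    moreover have "\<exists>i\<in>A. ?z i \<noteq> 0"
    proof (cases "t = 0")
      case True
      then show ?thesis using y by auto
    next
      case False
      then have "?z q \<noteq> 0" using x(3) y(2) by simp
      then show ?thesis using x(2) by blast
    qed
    ultimately show ?thesis using x(1) y(1) by (intro exI[of _ ?z]) auto
  qed
qed

text \<open>To hit \<open>b\<close>, an additional unknown \<open>x None\<close> is introduced as a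
  factor of \<open>b\<close>. There are then more unknowns than equations; injectivity excludes a
  nonzero solution with \<open>x None = 0\<close>, so one can divide by
  \<open>x None\<close>.\<close>

lemma onto_at_if_inj_at:
  fixes c :: "'a \<Rightarrow> 'k::field"
  assumes "finite V" and inj: "inj_at c E V k"
    and card: "card (indep_sets E V (Suc k)) \<le> card (indep_sets E V k)"
  shows "onto_at c E V (Suc k)"
  unfolding onto_at_def
proof
  fix b
  let ?A = "insert None (Some ` indep_sets E V k)"
  let ?L = "\<lambda>T x. lin_mult c (\<lambda>S. x (Some S)) T - x None * b T"
  have "card ?A = Suc (card (indep_sets E V k))"
    using assms(1) by (subst card_insert_disjoint) (auto simp: card_image)
  then obtain x where x: "\<forall>i. i \<notin> ?A \<longrightarrow> x i = 0" "\<exists>i\<in>?A. x i \<noteq> 0"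
      "\<forall>T\<in>indep_sets E V (Suc k). ?L T x = 0"
    using homogeneous_system_solution[of "indep_sets E V (Suc k)" ?A ?L] assms(1) card
    by (auto simp: lin_mult_linear algebra_simps)
  have "x None \<noteq> 0"
  proof
    assume "x None = 0"
    then have "\<forall>S\<in>indep_sets E V k. x (Some S) = 0"
      using x(3) inj unfolding inj_at_def by auto
    then show False using x(2) \<open>x None = 0\<close> by auto
  qed
  moreover have "lin_mult c (\<lambda>S. x (Some S) / x None) T = lin_mult c (\<lambda>S. x (Some S)) T / x None" for T
    by (simp add: lin_mult_def sum_divide_distrib)
  ultimately have "\<forall>T\<in>indep_sets E V (Suc k). lin_mult c (\<lambda>S. x (Some S) / x None) T = b T"
    using x(3) by simp
  then show "\<exists>a. \<forall>T\<in>indep_sets E V (Suc k). lin_mult c a T = b T" by blast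
qed

section \<open>Contraction with a functional on two vertices\<close>

text \<open>Removing \<open>u\<close> from \<open>insert u T\<close> and \<open>w\<close> from
  \<open>insert w T\<close> both leave \<open>T\<close>, and the hypothesis on \<open>p\<close> and
  \<open>q\<close> cancels these two terms. What remains is the product with the contracted
  element.\<close>

lemma lin_mult_edge:
  assumes "finite T" "u \<notin> T" "w \<notin> T" "p * c u + q * c w = 0"
  shows "p * lin_mult c a (insert u T) + q * lin_mult c a (insert w T)
    = lin_mult c (\<lambda>S. p * a (insert u S) + q * a (insert w S)) T"
proof -
  have "p * (c u * a T) + q * (c w * a T) = (p * c u + q * c w) * a T"
    by (simp add: algebra_simps)
  then have "p * (c u * a T) + q * (c w * a T) = 0" using assms by simp
  moreover have "lin_mult c (\<lambda>S. p * a (insert u S) + q * a (insert w S)) T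
    = p * lin_mult c (\<lambda>S. a (insert u S)) T + q * lin_mult c (\<lambda>S. a (insert w S)) T"
    by (simp add: lin_mult_def sum.distrib sum_distrib_left algebra_simps)
  ultimately show ?thesis
    using assms by (simp add: lin_mult_insert algebra_simps)
qed

lemma annihilator_exists:
  fixes x y :: "'k::field"
  shows "\<exists>p q. p * x + q * y = 0 \<and> (p \<noteq> 0 \<or> q \<noteq> 0)"
proof (cases "x = 0")
  case True
  then show ?thesis by (intro exI[of _ 1] exI[of _ 0]) simp
next
  case False
  then show ?thesis by (intro exI[of _ "- y"] exI[of _ x]) simp
qed

lemma indep_sets_insert_far:
  assumes "S \<in> indep_sets E W k" "u \<notin> W" "{u} \<notin> E" "\<And>v. v \<in> W \<Longrightarrow> {v, u} \<notin> E" "insert u W \<subseteq> V"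
  shows "insert u S \<in> indep_sets E V (Suc k)"
proof -
  have "away E u W = W" using assms(4) by (auto simp: away_def)
  then show ?thesis
    using indep_sets_insert[of S E u W k] assms indep_sets_mono[of "insert u W" V] by simp
qed

text \<open>Contracting with the functional on \<open>{u, w}\<close> that kills the linear form commutes with the
  multiplication maps.\<close>
lemma onto_at_remove_pair:
  fixes c :: "'a \<Rightarrow> 'k::field"
  assumes onto: "onto_at c E V (Suc k)"
    and sub: "insert u (insert w W) \<subseteq> V" and uw: "u \<noteq> w" "u \<notin> W" "w \<notin> W"
    and E: "{u} \<notin> E" "{w} \<notin> E" "\<And>v. v \<in> W \<Longrightarrow> {v, u} \<notin> E" "\<And>v. v \<in> W \<Longrightarrow> {v, w} \<notin> E"
  shows "onto_at c E W k"
  unfolding onto_at_def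
proof
  fix b
  obtain p q where pq: "p * c u + q * c w = 0" "p \<noteq> 0 \<or> q \<noteq> 0"
    using annihilator_exists by blast
  \<comment> \<open>A preimage of \<open>b\<close> under the contraction: the value is placed on the
    sets \<open>insert u T\<close> if \<open>p \<noteq> 0\<close>, and on the sets
    \<open>insert w T\<close> otherwise.\<close>
  define b' where "b' = (\<lambda>T. if u \<in> T then (if p = 0 then 0 else b (T - {u}) / p)
     else (if p = 0 then b (T - {w}) / q else 0))"
  obtain a where a: "\<forall>T\<in>indep_sets E V (Suc k). lin_mult c a T = b' T"
    using onto unfolding onto_at_def by blast
  have "lin_mult c (\<lambda>S. p * a (insert u S) + q * a (insert w S)) T = b T"
    if T: "T \<in> indep_sets E W k" for T
  proof -
    have T': "finite T" "u \<notin> T" "w \<notin> T" using T uw by (auto simp: indep_sets_def)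
    have "insert u T \<in> indep_sets E V (Suc k)" "insert w T \<in> indep_sets E V (Suc k)"
      using indep_sets_insert_far[OF T, of u V] indep_sets_insert_far[OF T, of w V] assms by auto
    then have "p * lin_mult c a (insert u T) + q * lin_mult c a (insert w T)
        = p * b' (insert u T) + q * b' (insert w T)"
      using a by simp
    also have "\<dots> = b T" using T' uw pq(2) by (auto simp: b'_def)
    finally show ?thesis using lin_mult_edge[OF T', of p c q a] pq(1) by simp
  qed
  then show "\<exists>a. \<forall>T\<in>indep_sets E W k. lin_mult c a T = b T" by blast
qed

text \<open>Multiplication maps the kernel of the contraction in degree k + 1 into its kernel in
  degree k + 2. The former has dimension at least
  \<open>card (indep_sets E V (Suc k)) - card (indep_sets E W k)\<close>; the latter has dimension
  \<open>card (indep_sets E V (Suc (Suc k))) - card (indep_sets E W (Suc k))\<close>, as the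
  contraction is onto.\<close>

lemma inj_at_pair_card:
  fixes c :: "'a \<Rightarrow> 'k::field"
  assumes inj: "inj_at c E V (Suc k)" and fin: "finite V"
    and sub: "insert u (insert w W) \<subseteq> V" and uw: "u \<noteq> w" "u \<notin> W" "w \<notin> W"
    and E: "{u} \<notin> E" "{w} \<notin> E" "\<And>v. v \<in> W \<Longrightarrow> {v, u} \<notin> E" "\<And>v. v \<in> W \<Longrightarrow> {v, w} \<notin> E"
  shows "card (indep_sets E V (Suc k)) + card (indep_sets E W (Suc k))
    \<le> card (indep_sets E V (Suc (Suc k))) + card (indep_sets E W k)"
proof (rule ccontr)
  assume less: "\<not> ?thesis"
  obtain p q where pq: "p * c u + q * c w = 0" "p \<noteq> 0 \<or> q \<noteq> 0"
    using annihilator_exists by blast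
  \<comment> \<open>The vertex \<open>r\<close> has a nonzero coefficient in the functional. Once
    the contraction of \<open>x\<close> vanishes, the equation at \<open>insert r T\<close> follows
    from the other equations, so the sets in \<open>?J\<close> can be left out of the
    system.\<close>
  define r where "r = (if p = 0 then w else u)"
  let ?I = "indep_sets E V (Suc (Suc k))" and ?J = "insert r ` indep_sets E W (Suc k)"
  let ?L = "\<lambda>j x. case j of Inl T \<Rightarrow> lin_mult c x T | Inr S \<Rightarrow> p * x (insert u S) + q * x (insert w S)"
  have finW: "finite W" using fin sub by (auto intro: finite_subset)
  have ins: "insert u T \<in> indep_sets E V (Suc l)" "insert w T \<in> indep_sets E V (Suc l)"
    if "T \<in> indep_sets E W l" for T l
    using indep_sets_insert_far[OF that, of u V] indep_sets_insert_far[OF that, of w V] assms by auto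
  have J: "?J \<subseteq> ?I" using ins by (auto simp: r_def)
  have "r \<notin> S" if "S \<in> indep_sets E W (Suc k)" for S
    using that uw by (auto simp: r_def indep_sets_def)
  then have "inj_on (insert r) (indep_sets E W (Suc k))"
    by (intro inj_onI) (metis insert_ident)
  then have "card ?J = card (indep_sets E W (Suc k))" by (rule card_image)
  then have "card (?I - ?J) + card (indep_sets E W (Suc k)) = card ?I"
    using J fin by (metis card_Diff_subset card_mono finite_indep_sets finite_subset le_add_diff_inverse2)
  then have "card ((?I - ?J) <+> indep_sets E W k) < card (indep_sets E V (Suc k))"
    using less fin finW by (subst card_Plus) auto
  moreover have "?L j (\<lambda>S. x S + t * y S) = ?L j x + t * ?L j y" for j x y t
    by (simp add: lin_mult_linear algebra_simps split: sum.split)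
  ultimately have "\<exists>x. (\<forall>S. S \<notin> indep_sets E V (Suc k) \<longrightarrow> x S = 0) \<and>
      (\<exists>S\<in>indep_sets E V (Suc k). x S \<noteq> 0) \<and> (\<forall>j\<in>(?I - ?J) <+> indep_sets E W k. ?L j x = 0)"
    by (intro homogeneous_system_solution) (simp_all add: fin finW)
  then obtain x where x: "\<exists>S\<in>indep_sets E V (Suc k). x S \<noteq> 0"
      "\<forall>j\<in>(?I - ?J) <+> indep_sets E W k. ?L j x = 0"
    by blast
  have x1: "lin_mult c x T = 0" if "T \<in> ?I" "T \<notin> ?J" for T
    using bspec[OF x(2) InlI, of T] that by simp
  have x2: "p * x (insert u S) + q * x (insert w S) = 0" if "S \<in> indep_sets E W k" for S
    using bspec[OF x(2) InrI, of S] that by simp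
  have "lin_mult c x (insert r T) = 0" if T: "T \<in> indep_sets E W (Suc k)" for T
  proof -
    have T': "finite T" "u \<notin> T" "w \<notin> T" using T uw by (auto simp: indep_sets_def)
    have "lin_mult c (\<lambda>S. p * x (insert u S) + q * x (insert w S)) T = 0"
      using x2 indep_sets_remove[OF T] by (intro lin_mult_zero) blast
    then have eq: "p * lin_mult c x (insert u T) + q * lin_mult c x (insert w T) = 0"
      using lin_mult_edge[OF T', of p c q x] pq(1) by simp
    show ?thesis
    proof (cases "p = 0")
      case True
      then show ?thesis using eq pq(2) by (simp add: r_def)
    next
      case False
      then have "insert w T \<notin> ?J" using T' uw by (auto simp: r_def)
      then show ?thesis using eq x1 ins(2)[OF T] False by (simp add: r_def)
    qed
  qed
  then have "\<forall>T\<in>?I. lin_mult c x T = 0" using x1 by blast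
  then show False using inj x(1) unfolding inj_at_def by blast
qed

section \<open>Adjacency in the tadpole graph\<close>

text \<open>The graph seen as the path 1, ..., m + 2 with the additional edge between 1 and m. The
  quantifier-free form can be evaluated, which the certificates at the end rely on.\<close>

definition tadpole_adj :: "nat \<Rightarrow> nat \<Rightarrow> nat \<Rightarrow> bool" where
  "tadpole_adj m u v \<longleftrightarrow>
     (Suc u = v \<and> 1 \<le> u \<and> v \<le> m + 2) \<or> (Suc v = u \<and> 1 \<le> v \<and> u \<le> m + 2)
     \<or> (u = 1 \<and> v = m) \<or> (u = m \<and> v = 1)"

lemma tadpole_edges_iff:
  assumes "m \<ge> 3"
  shows "{u, v} \<in> tadpole_edges m 2 \<longleftrightarrow> tadpole_adj m u v"
proof -
  have cycle: "{u, v} \<in> {{i, i + 1} | i. 1 \<le> i \<and> i \<le> m - 1} \<longleftrightarrow>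
      (Suc u = v \<and> 1 \<le> u \<and> u \<le> m - 1) \<or> (Suc v = u \<and> 1 \<le> v \<and> v \<le> m - 1)"
    by (auto simp: doubleton_eq_iff)
  have tail: "{{m + j, m + j + 1} | j. 1 \<le> j \<and> j \<le> 2 - (1::nat)} = {{m + 1, m + 2}}"
  proof -
    have "1 \<le> j \<and> j \<le> 2 - 1 \<longleftrightarrow> j = 1" for j :: nat by auto
    then show ?thesis by simp
  qed
  have "{u, v} \<in> tadpole_edges m 2 \<longleftrightarrow>
      (Suc u = v \<and> 1 \<le> u \<and> u \<le> m - 1) \<or> (Suc v = u \<and> 1 \<le> v \<and> v \<le> m - 1)
      \<or> {u, v} = {m, 1} \<or> {u, v} = {m + 1, m + 2} \<or> {u, v} = {m, m + 1}"
    unfolding tadpole_edges_def tail Un_iff cycle by (simp only: singleton_iff disj_assoc)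
  moreover have bridge: "Suc x = y \<and> 1 \<le> x \<and> y \<le> m + 2 \<longleftrightarrow>
      (Suc x = y \<and> 1 \<le> x \<and> x \<le> m - 1) \<or> (x = m + 1 \<and> y = m + 2) \<or> (x = m \<and> y = m + 1)" for x y
    using assms by (cases "y = Suc x") auto
  ultimately show ?thesis
    unfolding tadpole_adj_def bridge doubleton_eq_iff by argo
qed

lemma tadpole_adj_irrefl: "m \<ge> 3 \<Longrightarrow> \<not> tadpole_adj m v v"
  by (auto simp: tadpole_adj_def)

lemma tadpole_loopless: "m \<ge> 3 \<Longrightarrow> {v} \<notin> tadpole_edges m 2"
  using tadpole_edges_iff[of m v v] by (simp add: tadpole_adj_irrefl)

section \<open>Squarefree monomials\<close>

definition sqfree :: "nat set \<Rightarrow> nat \<Rightarrow>\<^sub>0 nat" where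
  "sqfree S = (\<Sum>i\<in>S. Poly_Mapping.single i 1)"

lemma lookup_sqfree: "finite S \<Longrightarrow> Poly_Mapping.lookup (sqfree S) i = (if i \<in> S then 1 else 0)"
  by (simp add: sqfree_def lookup_sum lookup_single when_def)

lemma keys_sqfree: "finite S \<Longrightarrow> Poly_Mapping.keys (sqfree S) = S"
  by (auto simp: in_keys_iff lookup_sqfree split: if_splits)

lemma mon_deg_sqfree: "finite S \<Longrightarrow> mon_deg (sqfree S) = card S"
  by (simp add: mon_deg_def keys_sqfree lookup_sqfree)

lemma sqfree_eq_iff: "finite S \<Longrightarrow> finite T \<Longrightarrow> sqfree S = sqfree T \<longleftrightarrow> S = T"
  by (metis keys_sqfree)

lemma sqfree_remove: "finite T \<Longrightarrow> i \<in> T \<Longrightarrow> sqfree T = Poly_Mapping.single i 1 + sqfree (T - {i})"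
  by (simp add: sqfree_def sum.remove)

lemma mpoly_expand: "(\<Sum>\<alpha>\<in>Poly_Mapping.keys f. Poly_Mapping.single \<alpha> (Poly_Mapping.lookup f \<alpha>)) = f"
  by (rule poly_mapping_eqI) (simp add: lookup_sum lookup_single when_def in_keys_iff)

lemma lookup_single_mult:
  fixes f :: "'k::comm_ring_1 mpoly"
  shows "Poly_Mapping.lookup (Poly_Mapping.single \<beta> x * f) (\<beta> + \<alpha>) = x * Poly_Mapping.lookup f \<alpha>"
proof -
  have "Poly_Mapping.single \<beta> x * f =
      (\<Sum>\<gamma>\<in>Poly_Mapping.keys f. Poly_Mapping.single (\<beta> + \<gamma>) (x * Poly_Mapping.lookup f \<gamma>))"
    by (subst mpoly_expand[of f, symmetric]) (simp add: sum_distrib_left mult_single)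
  then show ?thesis by (simp add: lookup_sum lookup_single when_def in_keys_iff)
qed

lemma lookup_mult_eq_0:
  fixes f g :: "'k::comm_ring_1 mpoly"
  assumes "\<And>\<beta> \<gamma>. \<beta> \<in> Poly_Mapping.keys f \<Longrightarrow> \<gamma> \<in> Poly_Mapping.keys g \<Longrightarrow> \<alpha> \<noteq> \<beta> + \<gamma>"
  shows "Poly_Mapping.lookup (f * g) \<alpha> = 0"
proof (rule ccontr)
  assume "Poly_Mapping.lookup (f * g) \<alpha> \<noteq> 0"
  then have "\<alpha> \<in> Poly_Mapping.keys (f * g)" by (simp add: in_keys_iff)
  then show False using assms keys_mult[of f g] by blast
qed

lemma keys_add_nat:
  fixes \<alpha> \<beta> :: "nat \<Rightarrow>\<^sub>0 nat"
  shows "Poly_Mapping.keys (\<alpha> + \<beta>) = Poly_Mapping.keys \<alpha> \<union> Poly_Mapping.keys \<beta>"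
  by (auto simp: in_keys_iff lookup_add)

lemma polys_add: "f \<in> polys N \<Longrightarrow> g \<in> polys N \<Longrightarrow> f + g \<in> polys N"
  using keys_add[of f g] by (fastforce simp: polys_def)

lemma polys_diff:
  fixes f g :: "'k::comm_ring_1 mpoly"
  shows "f \<in> polys N \<Longrightarrow> g \<in> polys N \<Longrightarrow> f - g \<in> polys N"
  using keys_diff[of f g] by (fastforce simp: polys_def)

lemma polys_mult:
  fixes f g :: "'k::comm_ring_1 mpoly"
  shows "f \<in> polys N \<Longrightarrow> g \<in> polys N \<Longrightarrow> f * g \<in> polys N"
  using keys_mult[of f g] by (fastforce simp: polys_def keys_add_nat)

lemma polys_sum: "(\<And>i. i \<in> A \<Longrightarrow> f i \<in> polys N) \<Longrightarrow> sum f A \<in> polys N"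
proof (induction A rule: infinite_finite_induct)
  case (insert x F)
  then show ?case by (simp add: polys_add)
qed (auto simp: polys_def)

lemma polys_single: "Poly_Mapping.keys \<alpha> \<subseteq> {1..N} \<Longrightarrow> Poly_Mapping.single \<alpha> x \<in> polys N"
  by (auto simp: polys_def)

lemma var_mult_var:
  "(var i * var j :: 'k::comm_ring_1 mpoly)
    = Poly_Mapping.single (Poly_Mapping.single i 1 + Poly_Mapping.single j 1) 1"
  by (simp add: var_def mult_single)

lemma homog_lookup_sqfree:
  assumes "homog j f" "finite S" "card S \<noteq> j"
  shows "Poly_Mapping.lookup f (sqfree S) = 0"
  using assms mon_deg_sqfree[OF assms(2)] unfolding homog_def by (metis in_keys_iff)

lemma ideal_gen_add: "f \<in> ideal_gen N S \<Longrightarrow> g \<in> ideal_gen N S \<Longrightarrow> f + g \<in> ideal_gen N S"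
proof (induction rule: ideal_gen.induct)
  case zero
  then show ?case by simp
next
  case (step g' h f)
  then show ?case using ideal_gen.step[of g' S h N "f + g"] by (simp add: add.assoc)
qed

lemma ideal_gen_sum: "(\<And>i. i \<in> A \<Longrightarrow> f i \<in> ideal_gen N S) \<Longrightarrow> sum f A \<in> ideal_gen N S"
proof (induction A rule: infinite_finite_induct)
  case (insert x F)
  then show ?case by (simp add: ideal_gen_add)
qed (auto simp: ideal_gen.zero)

section \<open>The Lefschetz property in terms of independent sets\<close>

text \<open>Every monomial of a multiple of a generator is divisible by a square or by both ends of
  an edge, so it is never the squarefree monomial of an independent set.\<close>

lemma AG_ideal_lookup_sqfree:
  fixes f :: "'k::comm_ring_1 mpoly"
  assumes "f \<in> ideal_gen N (AG_gens N E)" and S: "S \<in> indep_sets E V k"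
  shows "Poly_Mapping.lookup f (sqfree S) = 0"
  using assms(1)
proof (induction rule: ideal_gen.induct)
  case zero
  then show ?case by simp
next
  case (step g h f)
  have fin: "finite S" using S by (simp add: indep_sets_def)
  obtain i j where g: "g = Poly_Mapping.single (Poly_Mapping.single i 1 + Poly_Mapping.single j 1) 1"
    and ij: "i = j \<or> {i, j} \<in> E"
    using step.hyps(1) by (auto simp: AG_gens_def var_mult_var)
  have "Poly_Mapping.lookup (h * g) (sqfree S) = 0"
  proof (rule lookup_mult_eq_0)
    fix \<beta> \<gamma> assume "\<gamma> \<in> Poly_Mapping.keys g"
    then have \<gamma>: "\<gamma> = Poly_Mapping.single i 1 + Poly_Mapping.single j 1"
      using g by (auto split: if_splits)
    show "sqfree S \<noteq> \<beta> + \<gamma>"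
    proof
      assume eq: "sqfree S = \<beta> + \<gamma>"
      have "(if n \<in> S then 1 else 0) = Poly_Mapping.lookup \<beta> n + (1 when i = n) + (1 when j = n)" for n
        using arg_cong[OF eq, of "\<lambda>p. Poly_Mapping.lookup p n"] fin
        by (simp add: lookup_sqfree \<gamma> lookup_add lookup_single)
      from this[of i] this[of j] have "i \<in> S" "j \<in> S" "i \<noteq> j"
        by (auto simp: when_def split: if_splits)
      then show False using ij S by (auto simp: indep_sets_def)
    qed
  qed
  then show ?case using step.IH by (simp add: lookup_add)
qed

text \<open>Such a monomial has an exponent of at least 2, or it is squarefree and its support
  contains an edge; either way some generator divides it.\<close>

lemma single_in_AG_ideal:
  assumes loopless: "\<And>v. {v} \<notin> E"
    and "Poly_Mapping.keys \<alpha> \<subseteq> {1..N}" "\<And>k S. S \<in> indep_sets E {1..N} k \<Longrightarrow> \<alpha> \<noteq> sqfree S"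
  shows "(Poly_Mapping.single \<alpha> x :: 'k::comm_ring_1 mpoly) \<in> ideal_gen N (AG_gens N E)"
proof -
  \<comment> \<open>The inequality says that x_i x_j divides the monomial; for \<open>i = j\<close>
    it covers the squares as well.\<close>
  have "\<exists>i j. (\<forall>n. (1 when i = n) + (1 when j = n) \<le> Poly_Mapping.lookup \<alpha> n)
      \<and> (var i * var j :: 'k mpoly) \<in> AG_gens N E"
  proof (cases "\<exists>i. Poly_Mapping.lookup \<alpha> i \<ge> 2")
    case True
    then obtain i where i: "Poly_Mapping.lookup \<alpha> i \<ge> 2" by blast
    then have "i \<in> Poly_Mapping.keys \<alpha>" by (simp add: in_keys_iff)
    then have "i \<in> {1..N}" using assms(2) by blast
    then show ?thesis using i by (intro exI[of _ i]) (auto simp: AG_gens_def when_def)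
  next
    case False
    then have le: "Poly_Mapping.lookup \<alpha> i \<le> 1" for i by (metis not_less_eq_eq numeral_2_eq_2 One_nat_def)
    have "\<alpha> = sqfree (Poly_Mapping.keys \<alpha>)"
    proof (rule poly_mapping_eqI)
      fix n show "Poly_Mapping.lookup \<alpha> n = Poly_Mapping.lookup (sqfree (Poly_Mapping.keys \<alpha>)) n"
        using le[of n] by (auto simp: lookup_sqfree in_keys_iff)
    qed
    then have "Poly_Mapping.keys \<alpha> \<notin> indep_sets E {1..N} (card (Poly_Mapping.keys \<alpha>))"
      using assms(3) by blast
    then obtain u v where uv: "u \<in> Poly_Mapping.keys \<alpha>" "v \<in> Poly_Mapping.keys \<alpha>" "{u, v} \<in> E"
      using assms(2) by (auto simp: indep_sets_def)
    have "u \<noteq> v" using uv(3) loopless by auto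
    then show ?thesis using uv
      by (intro exI[of _ u] exI[of _ v]) (auto simp: AG_gens_def when_def in_keys_iff)
  qed
  then obtain i j where le: "\<And>n. (1 when i = n) + (1 when j = n) \<le> Poly_Mapping.lookup \<alpha> n"
    and gen: "(var i * var j :: 'k mpoly) \<in> AG_gens N E" by blast
  define \<beta> where "\<beta> = Poly_Mapping.single i 1 + (Poly_Mapping.single j 1 :: nat \<Rightarrow>\<^sub>0 nat)"
  \<comment> \<open>Subtraction of exponents is truncated; divisibility makes it exact.\<close>
  have \<alpha>: "\<alpha> = (\<alpha> - \<beta>) + \<beta>"
    by (rule poly_mapping_eqI) (use le in \<open>simp add: \<beta>_def lookup_add lookup_minus lookup_single\<close>)
  have "Poly_Mapping.keys (\<alpha> - \<beta>) \<subseteq> Poly_Mapping.keys \<alpha>"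
    by (subst (2) \<alpha>) (simp add: keys_add_nat)
  then have "Poly_Mapping.single (\<alpha> - \<beta>) x \<in> polys N" using assms(2) by (intro polys_single) blast
  then have "Poly_Mapping.single (\<alpha> - \<beta>) x * (var i * var j) + 0 \<in> ideal_gen N (AG_gens N E)"
    using gen by (intro ideal_gen.step ideal_gen.zero)
  moreover have "Poly_Mapping.single (\<alpha> - \<beta>) x * (var i * var j) = Poly_Mapping.single \<alpha> x"
    using \<alpha> by (simp add: var_mult_var mult_single \<beta>_def)
  ultimately show ?thesis by simp
qed

text \<open>The ideal is monomial, so membership can be decided monomial by monomial. Hence the
  squarefree monomials of independent sets form a basis of A(G).\<close>

lemma mem_AG_ideal_iff:
  fixes f :: "'k::comm_ring_1 mpoly"
  assumes loopless: "\<And>v. {v} \<notin> E" and "f \<in> polys N"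
  shows "f \<in> AG_ideal TYPE('k) N E \<longleftrightarrow>
    (\<forall>k. \<forall>S\<in>indep_sets E {1..N} k. Poly_Mapping.lookup f (sqfree S) = 0)" (is "_ \<longleftrightarrow> ?R")
proof
  assume "f \<in> AG_ideal TYPE('k) N E"
  then show ?R unfolding AG_ideal_def using AG_ideal_lookup_sqfree by blast
next
  assume R: ?R
  have "(\<Sum>\<alpha>\<in>Poly_Mapping.keys f. Poly_Mapping.single \<alpha> (Poly_Mapping.lookup f \<alpha>))
      \<in> ideal_gen N (AG_gens N E)"
  proof (rule ideal_gen_sum)
    fix \<alpha> assume \<alpha>: "\<alpha> \<in> Poly_Mapping.keys f"
    show "Poly_Mapping.single \<alpha> (Poly_Mapping.lookup f \<alpha>) \<in> ideal_gen N (AG_gens N E)"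
      using assms(2) \<alpha> R by (intro single_in_AG_ideal loopless) (auto simp: polys_def in_keys_iff)
  qed
  then show "f \<in> AG_ideal TYPE('k) N E" unfolding AG_ideal_def by (simp add: mpoly_expand)
qed

definition lin_form :: "nat \<Rightarrow> (nat \<Rightarrow> 'k) \<Rightarrow> 'k::comm_ring_1 mpoly" where
  "lin_form N c = (\<Sum>i\<in>{1..N}. Poly_Mapping.single 0 (c i) * var i)"

lemma lin_form_polys: "lin_form N c \<in> polys N"
  unfolding lin_form_def
  by (intro polys_sum) (auto simp: var_def mult_single intro!: polys_single)

text \<open>The link between polynomials and \<open>lin_mult\<close>: x_i contributes to the
  coefficient at x_T only for \<open>i \<in> T\<close>, through the coefficient at x_(T -
  i).\<close>

lemma lookup_lin_form_mult:
  fixes f :: "'k::comm_ring_1 mpoly"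
  assumes "finite T" "T \<subseteq> {1..N}"
  shows "Poly_Mapping.lookup (lin_form N c * f) (sqfree T)
    = lin_mult c (\<lambda>S. Poly_Mapping.lookup f (sqfree S)) T"
proof -
  have "Poly_Mapping.lookup (Poly_Mapping.single 0 (c i) * var i * f) (sqfree T)
      = (if i \<in> T then c i * Poly_Mapping.lookup f (sqfree (T - {i})) else 0)" for i
  proof (cases "i \<in> T")
    case True
    then show ?thesis
      using lookup_single_mult[of "Poly_Mapping.single i 1" "c i" f "sqfree (T - {i})"] assms(1)
      by (simp add: var_def mult_single sqfree_remove)
  next
    case False
    have "Poly_Mapping.lookup (Poly_Mapping.single (Poly_Mapping.single i 1) (c i) * f) (sqfree T) = 0"
    proof (rule lookup_mult_eq_0)
      fix \<beta> \<gamma> assume "\<beta> \<in> Poly_Mapping.keys (Poly_Mapping.single (Poly_Mapping.single i (1::nat)) (c i))"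
      then have "Poly_Mapping.lookup (\<beta> + \<gamma>) i \<noteq> 0"
        by (auto simp: lookup_add split: if_splits)
      moreover have "Poly_Mapping.lookup (sqfree T) i = 0" using False assms(1) by (simp add: lookup_sqfree)
      ultimately show "sqfree T \<noteq> \<beta> + \<gamma>" by metis
    qed
    then show ?thesis using False by (simp add: var_def mult_single)
  qed
  then have "Poly_Mapping.lookup (lin_form N c * f) (sqfree T)
      = (\<Sum>i\<in>{1..N}. if i \<in> T then c i * Poly_Mapping.lookup f (sqfree (T - {i})) else 0)"
    by (simp add: lin_form_def sum_distrib_right lookup_sum)
  also have "\<dots> = (\<Sum>i\<in>T. c i * Poly_Mapping.lookup f (sqfree (T - {i})))"
    using assms by (simp add: sum.If_cases Int_absorb1)
  finally show ?thesis by (simp add: lin_mult_def)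
qed

definition indep_poly :: "nat set set \<Rightarrow> (nat set \<Rightarrow> 'k) \<Rightarrow> 'k::comm_ring_1 mpoly" where
  "indep_poly I a = (\<Sum>S\<in>I. Poly_Mapping.single (sqfree S) (a S))"

lemma lookup_indep_poly:
  assumes "finite V" "S \<in> indep_sets E V k"
  shows "Poly_Mapping.lookup (indep_poly (indep_sets E V k) a) (sqfree S) = a S"
proof -
  have "Poly_Mapping.lookup (indep_poly (indep_sets E V k) a) (sqfree S)
      = (\<Sum>T\<in>indep_sets E V k. if T = S then a T else 0)"
    unfolding indep_poly_def lookup_sum using assms(2)
    by (intro sum.cong) (auto simp: lookup_single when_def sqfree_eq_iff indep_sets_def)
  then show ?thesis using assms by simp
qed

lemma indep_poly_polys: "indep_poly (indep_sets E {1..N} k) a \<in> polys N"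
  unfolding indep_poly_def by (intro polys_sum polys_single) (auto simp: indep_sets_def keys_sqfree)

lemma indep_poly_homog: "homog k (indep_poly (indep_sets E V k) a)"
  unfolding homog_def
proof
  fix \<alpha> assume "\<alpha> \<in> Poly_Mapping.keys (indep_poly (indep_sets E V k) a)"
  then have "(\<Sum>S\<in>indep_sets E V k. Poly_Mapping.lookup (Poly_Mapping.single (sqfree S) (a S)) \<alpha>) \<noteq> 0"
    by (simp add: indep_poly_def in_keys_iff lookup_sum)
  then obtain S where "S \<in> indep_sets E V k" "Poly_Mapping.lookup (Poly_Mapping.single (sqfree S) (a S)) \<alpha> \<noteq> 0"
    by (meson sum.not_neutral_contains_not_neutral)
  then show "mon_deg \<alpha> = k"
    by (auto simp: indep_sets_def mon_deg_sqfree lookup_single when_def split: if_splits)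
qed

lemma lookup_lin_form_mult_off_degree:
  fixes f :: "'k::comm_ring_1 mpoly"
  assumes "homog j f" "S \<in> indep_sets E {1..N} k" "k \<noteq> Suc j"
  shows "Poly_Mapping.lookup (lin_form N c * f) (sqfree S) = 0"
proof -
  have "Poly_Mapping.lookup f (sqfree (S - {v})) = 0" if "v \<in> S" for v
    using assms that card_Suc_Diff1[of S v] by (intro homog_lookup_sqfree) (auto simp: indep_sets_def)
  then show ?thesis using assms(2)
    by (simp add: lookup_lin_form_mult indep_sets_def lin_mult_zero)
qed

text \<open>Coefficient functions and polynomials are exchanged through \<open>indep_poly\<close>
  and \<open>lookup\<close>. Ideal membership concerns all degrees, but by homogeneity every degree
  other than that of the element or product in question gives only zero coefficients.\<close>

lemma mult_inj_iff:
  fixes c :: "nat \<Rightarrow> 'k::comm_ring_1"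
  assumes loopless: "\<And>v. {v} \<notin> E"
  shows "mult_inj TYPE('k) N E (lin_form N c) j \<longleftrightarrow> inj_at c E {1..N} j"
proof
  assume inj: "mult_inj TYPE('k) N E (lin_form N c) j"
  show "inj_at c E {1..N} j"
    unfolding inj_at_def
  proof (intro allI impI ballI)
    fix a :: "nat set \<Rightarrow> 'k" and S
    assume ker: "\<forall>T\<in>indep_sets E {1..N} (Suc j). lin_mult c a T = 0" and S: "S \<in> indep_sets E {1..N} j"
    define f where "f = indep_poly (indep_sets E {1..N} j) a"
    have f: "f \<in> polys N" "homog j f" unfolding f_def by (rule indep_poly_polys indep_poly_homog)+
    have "Poly_Mapping.lookup (lin_form N c * f) (sqfree T) = 0" if T: "T \<in> indep_sets E {1..N} k" for k T
    proof (cases "k = Suc j")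
      case True
      have "lin_mult c (\<lambda>S. Poly_Mapping.lookup f (sqfree S)) T = lin_mult c a T"
        using indep_sets_remove T True unfolding f_def
        by (intro lin_mult_cong lookup_indep_poly) auto
      then show ?thesis using T True ker by (simp add: lookup_lin_form_mult indep_sets_def)
    next
      case False
      then show ?thesis using lookup_lin_form_mult_off_degree[OF f(2) T] by blast
    qed
    then have "lin_form N c * f \<in> AG_ideal TYPE('k) N E"
      using f by (subst mem_AG_ideal_iff[OF loopless]) (auto intro: polys_mult lin_form_polys)
    then have "f \<in> AG_ideal TYPE('k) N E" using inj f by (auto simp: mult_inj_def)
    then have "Poly_Mapping.lookup f (sqfree S) = 0" using f(1) S mem_AG_ideal_iff[OF loopless] by blast
    then show "a S = 0" using S by (simp add: f_def lookup_indep_poly)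
  qed
next
  assume inj: "inj_at c E {1..N} j"
  show "mult_inj TYPE('k) N E (lin_form N c) j"
    unfolding mult_inj_def
  proof (intro allI impI, elim conjE)
    fix f :: "'k mpoly" assume f: "f \<in> polys N" "homog j f" "lin_form N c * f \<in> AG_ideal TYPE('k) N E"
    have "lin_mult c (\<lambda>S. Poly_Mapping.lookup f (sqfree S)) T = 0"
      if "T \<in> indep_sets E {1..N} (Suc j)" for T
    proof -
      have "Poly_Mapping.lookup (lin_form N c * f) (sqfree T) = 0"
        using f mem_AG_ideal_iff[OF loopless polys_mult[OF lin_form_polys f(1)]] that by blast
      then show ?thesis using that by (simp add: lookup_lin_form_mult indep_sets_def)
    qed
    then have "\<forall>S\<in>indep_sets E {1..N} j. Poly_Mapping.lookup f (sqfree S) = 0"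
      using inj unfolding inj_at_def by blast
    moreover have "Poly_Mapping.lookup f (sqfree S) = 0" if "S \<in> indep_sets E {1..N} k" "k \<noteq> j" for k S
      using that f(2) by (intro homog_lookup_sqfree) (auto simp: indep_sets_def)
    ultimately show "f \<in> AG_ideal TYPE('k) N E" using f(1) by (subst mem_AG_ideal_iff[OF loopless]) blast+
  qed
qed

lemma mult_surj_iff:
  fixes c :: "nat \<Rightarrow> 'k::comm_ring_1"
  assumes loopless: "\<And>v. {v} \<notin> E"
  shows "mult_surj TYPE('k) N E (lin_form N c) j \<longleftrightarrow> onto_at c E {1..N} (Suc j)"
proof
  assume surj: "mult_surj TYPE('k) N E (lin_form N c) j"
  show "onto_at c E {1..N} (Suc j)"
    unfolding onto_at_def
  proof
    fix b :: "nat set \<Rightarrow> 'k"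
    define g where "g = indep_poly (indep_sets E {1..N} (Suc j)) b"
    have g: "g \<in> polys N" "homog (Suc j) g" unfolding g_def by (rule indep_poly_polys indep_poly_homog)+
    then obtain f where f: "f \<in> polys N" "homog j f" "g - lin_form N c * f \<in> AG_ideal TYPE('k) N E"
      using surj unfolding mult_surj_def by blast
    have "lin_mult c (\<lambda>S. Poly_Mapping.lookup f (sqfree S)) T = b T"
      if T: "T \<in> indep_sets E {1..N} (Suc j)" for T
    proof -
      have "Poly_Mapping.lookup (g - lin_form N c * f) (sqfree T) = 0"
        using f mem_AG_ideal_iff[OF loopless polys_diff[OF g(1) polys_mult[OF lin_form_polys f(1)]]] T by blast
      then show ?thesis using T
        by (simp add: lookup_minus lookup_lin_form_mult g_def lookup_indep_poly)
           (simp add: indep_sets_def lookup_lin_form_mult)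
    qed
    then show "\<exists>a. \<forall>T\<in>indep_sets E {1..N} (Suc j). lin_mult c a T = b T" by blast
  qed
next
  assume onto: "onto_at c E {1..N} (Suc j)"
  show "mult_surj TYPE('k) N E (lin_form N c) j"
    unfolding mult_surj_def
  proof (intro allI impI, elim conjE)
    fix g :: "'k mpoly" assume g: "g \<in> polys N" "homog (Suc j) g"
    obtain a where a: "\<forall>T\<in>indep_sets E {1..N} (Suc j). lin_mult c a T = Poly_Mapping.lookup g (sqfree T)"
      using onto[unfolded onto_at_def, rule_format, of "\<lambda>T. Poly_Mapping.lookup g (sqfree T)"] by blast
    define f where "f = indep_poly (indep_sets E {1..N} j) a"
    have f: "f \<in> polys N" "homog j f" unfolding f_def by (rule indep_poly_polys indep_poly_homog)+
    have "Poly_Mapping.lookup (g - lin_form N c * f) (sqfree T) = 0"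
      if T: "T \<in> indep_sets E {1..N} k" for k T
    proof (cases "k = Suc j")
      case True
      have "lin_mult c (\<lambda>S. Poly_Mapping.lookup f (sqfree S)) T = lin_mult c a T"
        using indep_sets_remove T True unfolding f_def
        by (intro lin_mult_cong lookup_indep_poly) auto
      moreover have "finite T" "T \<subseteq> {1..N}" using T by (auto simp: indep_sets_def)
      ultimately show ?thesis using T True a by (simp add: lookup_minus lookup_lin_form_mult)
    next
      case False
      then have "Poly_Mapping.lookup g (sqfree T) = 0"
        using T g(2) by (intro homog_lookup_sqfree) (auto simp: indep_sets_def)
      then show ?thesis using lookup_lin_form_mult_off_degree[OF f(2) T False] by (simp add: lookup_minus)
    qed
    then have "g - lin_form N c * f \<in> AG_ideal TYPE('k) N E"
      using f g by (subst mem_AG_ideal_iff[OF loopless]) (auto intro: polys_diff polys_mult lin_form_polys)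
    then show "\<exists>f. f \<in> polys N \<and> homog j f \<and> g - lin_form N c * f \<in> AG_ideal TYPE('k) N E"
      using f by blast
  qed
qed

text \<open>\<open>GREATEST\<close> can be used only for a bounded predicate; the bound is
  \<open>N\<close>, since a nonzero class of degree j yields an independent subset of
  \<open>{1..N}\<close> of size j.\<close>

lemma le_AG_top_degree:
  assumes loopless: "\<And>v. {v} \<notin> E" and "indep_sets E {1..N} k \<noteq> {}"
  shows "k \<le> AG_top_degree TYPE('k::comm_ring_1) N E"
  unfolding AG_top_degree_def
proof (rule Greatest_le_nat)
  obtain S where S: "S \<in> indep_sets E {1..N} k" using assms(2) by blast
  let ?f = "indep_poly (indep_sets E {1..N} k) (\<lambda>_. 1) :: 'k mpoly"
  have "Poly_Mapping.lookup ?f (sqfree S) \<noteq> 0"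
    using lookup_indep_poly[of "{1..N}" S E k "\<lambda>_. 1 :: 'k"] S by simp
  then show "\<exists>f::'k mpoly. f \<in> polys N \<and> homog k f \<and> f \<notin> AG_ideal TYPE('k) N E"
    using S mem_AG_ideal_iff[OF loopless indep_poly_polys] indep_poly_polys indep_poly_homog by metis
next
  fix j assume "\<exists>f::'k mpoly. f \<in> polys N \<and> homog j f \<and> f \<notin> AG_ideal TYPE('k) N E"
  then obtain f :: "'k mpoly" and l S where f: "homog j f" and S: "S \<in> indep_sets E {1..N} l"
      "Poly_Mapping.lookup f (sqfree S) \<noteq> 0"
    using mem_AG_ideal_iff[OF loopless] by blast
  then have "card S = j" using homog_lookup_sqfree[OF f] by (auto simp: indep_sets_def)
  moreover have "card S \<le> card {1..N}" using S by (intro card_mono) (auto simp: indep_sets_def)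
  ultimately show "j \<le> N" by simp
qed

lemma AG_has_WLP_iff:
  assumes loopless: "\<And>v. {v} \<notin> E"
  shows "AG_has_WLP TYPE('k::comm_ring_1) N E \<longleftrightarrow>
    (\<exists>c :: nat \<Rightarrow> 'k. \<forall>j < AG_top_degree TYPE('k) N E. inj_at c E {1..N} j \<or> onto_at c E {1..N} (Suc j))"
  unfolding AG_has_WLP_def lin_form_def[symmetric] Let_def mult_inj_iff[OF loopless] mult_surj_iff[OF loopless] ..

section \<open>Failure for the remaining tadpole graphs\<close>

text \<open>The bounds keep the interval inside \<open>{1..m - 1}\<close>, where the induced graph
  is a path. Splitting at its last vertex gives Pascal's rule.\<close>

lemma card_indep_sets_path:
  assumes m: "m \<ge> 3" and "1 \<le> a" "a + n \<le> m"
  shows "card (indep_sets (tadpole_edges m 2) {a..<a + n} k) = (n + 1 - k) choose k"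
  using assms(3)
proof (induction n arbitrary: k rule: less_induct)
  case (less n)
  show ?case
  proof (cases k)
    case 0
    then show ?thesis by simp
  next
    case (Suc k')
    show ?thesis
    proof (cases n)
      case 0
      then show ?thesis using Suc by simp
    next
      case (Suc n')
      have V: "{a..<a + n} = insert (a + n') {a..<a + n'}" using Suc by auto
      \<comment> \<open>For \<open>n' = 0\<close> the truncated \<open>n' - 1\<close> is 0, and the
        interval is rightly empty.\<close>
      have "away (tadpole_edges m 2) (a + n') {a..<a + n'} = {a..<a + (n' - 1)}"
        using assms less.prems Suc by (auto simp: away_def tadpole_edges_iff tadpole_adj_def)
      then have "card (indep_sets (tadpole_edges m 2) {a..<a + n} k)
          = card (indep_sets (tadpole_edges m 2) {a..<a + n'} (Suc k'))
            + card (indep_sets (tadpole_edges m 2) {a..<a + (n' - 1)} k')"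
        unfolding V \<open>k = Suc k'\<close> using m by (simp add: card_indep_sets_insert tadpole_loopless)
      also have "\<dots> = ((n' - k') choose Suc k') + ((n' - 1 + 1 - k') choose k')"
        using less Suc by simp
      also have "\<dots> = (Suc n' - k') choose Suc k'"
      proof (cases "k' \<le> n'")
        case True
        then show ?thesis by (cases n') (auto simp: Suc_diff_le)
      next
        case False
        then show ?thesis by simp
      qed
      finally show ?thesis using Suc \<open>k = Suc k'\<close> by simp
    qed
  qed
qed

text \<open>The number of independent sets of size \<open>k + 2\<close>. The first two summands
  count those without the vertex m, containing none or one of the two tail vertices besides a subset
  of the path 1, ..., m - 1. The last two count those with m, without or with the vertex m + 2, on
  the path 2, ..., m - 2. The shift by 2 keeps the lower entries free of subtraction.\<close>

definition tadpole_count :: "nat \<Rightarrow> nat \<Rightarrow> nat" where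
  "tadpole_count m k =
     ((m - k - 2) choose (k + 2)) + 2 * ((m - k - 1) choose (k + 1))
     + ((m - 3 - k) choose (k + 1)) + ((m - 2 - k) choose k)"

lemma card_indep_sets_tadpole:
  assumes m: "m \<ge> 3"
  shows "card (indep_sets (tadpole_edges m 2) {1..m + 2} (k + 2)) = tadpole_count m k"
proof -
  let ?E = "tadpole_edges m 2"
  let ?P = "{1..<1 + (m - 1)}" and ?Q = "{2..<2 + (m - 3)}"
  let ?W = "insert (m + 2) (insert (m + 1) ?P)"
  have V: "{1..m + 2} = insert m ?W" using m by auto
  have W: "away ?E m ?W = insert (m + 2) ?Q"
    using m by (auto simp: away_def tadpole_edges_iff tadpole_adj_def)
  have W': "away ?E (m + 2) (insert (m + 1) ?P) = ?P"
    using m by (auto simp: away_def tadpole_edges_iff tadpole_adj_def)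
  have "card (indep_sets ?E {1..m + 2} (Suc (Suc k)))
      = card (indep_sets ?E ?W (Suc (Suc k))) + card (indep_sets ?E (insert (m + 2) ?Q) (Suc k))"
    unfolding V W[symmetric] using m by (intro card_indep_sets_insert) (auto simp: tadpole_loopless)
  also have "card (indep_sets ?E ?W (Suc (Suc k)))
      = card (indep_sets ?E (insert (m + 1) ?P) (Suc (Suc k))) + card (indep_sets ?E ?P (Suc k))"
    by (subst card_indep_sets_insert, unfold W') (use m in \<open>auto simp: tadpole_loopless\<close>)
  also have "card (indep_sets ?E (insert (m + 1) ?P) (Suc (Suc k)))
      = card (indep_sets ?E ?P (Suc (Suc k))) + card (indep_sets ?E ?P (Suc k))"
    using m by (intro card_indep_sets_insert_isolated)
      (auto simp: tadpole_loopless tadpole_edges_iff tadpole_adj_def)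
  also have "card (indep_sets ?E (insert (m + 2) ?Q) (Suc k))
      = card (indep_sets ?E ?Q (Suc k)) + card (indep_sets ?E ?Q k)"
    using m by (intro card_indep_sets_insert_isolated)
      (auto simp: tadpole_loopless tadpole_edges_iff tadpole_adj_def)
  finally have "card (indep_sets ?E {1..m + 2} (Suc (Suc k)))
     = ((m - 1 + 1 - Suc (Suc k)) choose Suc (Suc k)) + ((m - 1 + 1 - Suc k) choose Suc k)
       + ((m - 1 + 1 - Suc k) choose Suc k)
       + (((m - 3 + 1 - Suc k) choose Suc k) + ((m - 3 + 1 - k) choose k))"
    using m by (subst (asm) (1 2 3 4 5) card_indep_sets_path) auto
  moreover have "m - 1 + 1 - Suc (Suc k) = m - k - 2" "m - 1 + 1 - Suc k = m - k - 1"
      "m - 3 + 1 - Suc k = m - 3 - k" "m - 3 + 1 - k = m - 2 - k"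
    using m by auto
  ultimately show ?thesis by (simp add: tadpole_count_def)
qed

text \<open>For \<open>k \<le> M\<close> the quotient of the two binomials is (M - k)(M + 1 - k) /
  ((k + 1)(M + 1)); the assumption says that it is at most 1.\<close>

lemma binomial_diagonal_le:
  assumes "(M - k) * (M + 1 - k) \<le> (k + 1) * (M + 1)"
  shows "M choose (k + 1) \<le> (M + 1) choose k"
proof -
  have a: "(k + 1) * (M choose (k + 1)) = (M - k) * (M choose k)"
  proof (cases "k \<le> M")
    case True
    then show ?thesis
      using binomial_absorption[of k M] binomial_absorb_comp[of M k] by simp
  next
    case False
    then show ?thesis by simp
  qed
  have b: "(M + 1 - k) * ((M + 1) choose k) = (M + 1) * (M choose k)"
    using binomial_absorb_comp[of "M + 1" k] by simp
  have "((k + 1) * (M + 1)) * (M choose (k + 1)) = (M - k) * ((M + 1) * (M choose k))"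
    using a by (metis mult.assoc mult.commute)
  also have "\<dots> = ((M - k) * (M + 1 - k)) * ((M + 1) choose k)"
    unfolding b[symmetric] by (simp only: mult.assoc)
  also have "\<dots> \<le> ((k + 1) * (M + 1)) * ((M + 1) choose k)"
    using assms by (rule mult_right_mono) simp
  finally show ?thesis by (subst (asm) nat_mult_le_cancel1) simp_all
qed

text \<open>The four summands are compared one by one. The bound 9 comes from the last one with
  \<open>r = 2\<close>, where the condition of \<open>binomial_diagonal_le\<close> becomes q^2 - 7q
  - 14 >= 0.\<close>

lemma tadpole_count_decreasing_large:
  assumes "q \<ge> 9" "r \<le> 2"
  shows "tadpole_count (3 * q + r) (q - 1) \<le> tadpole_count (3 * q + r) (q - 2)"
proof -
  obtain s where q: "q = s + 9" using assms(1) by (metis add.commute le_Suc_ex)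
  have r: "r = 0 \<or> r = 1 \<or> r = 2" using assms(2) by auto
  let ?m = "3 * q + r"
  have "(?m - (q - 1) - 2) choose (q + 1) \<le> (?m - q) choose q"
    using binomial_diagonal_le[of "2 * q + r - 1" q] r by (auto simp: q algebra_simps)
  moreover have "(?m - q) choose q \<le> (?m - (q - 1)) choose (q - 1)"
    using binomial_diagonal_le[of "2 * q + r" "q - 1"] r by (auto simp: q algebra_simps)
  moreover have "(?m - 3 - (q - 1)) choose q \<le> (?m - 2 - (q - 1)) choose (q - 1)"
    using binomial_diagonal_le[of "2 * q + r - 2" "q - 1"] r by (auto simp: q algebra_simps)
  moreover have "(?m - 2 - (q - 1)) choose (q - 1) \<le> (?m - 2 - (q - 2)) choose (q - 2)"
    using binomial_diagonal_le[of "2 * q + r - 1" "q - 2"] r by (auto simp: q algebra_simps)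
  moreover have "q - 1 + 2 = q + 1" "q - 1 + 1 = q" "q - 2 + 2 = q" "q - 2 + 1 = q - 1"
      "?m - (q - 1) - 1 = ?m - q" "?m - (q - 2) - 2 = ?m - q" "?m - (q - 2) - 1 = ?m - (q - 1)"
      "?m - 3 - (q - 2) = ?m - 2 - (q - 1)"
    by (auto simp: q)
  ultimately show ?thesis unfolding tadpole_count_def by simp
qed

section \<open>Failure of surjectivity from an induced matching\<close>

text \<open>Contracting with the last edge \<open>{n - 1, n}\<close> leaves the path on
  \<open>{1..n - 3}\<close>, since \<open>n - 2\<close> is a neighbour of that edge. After
  \<open>q\<close> contractions the target degree is 0, where nothing is onto.\<close>

lemma not_onto_at_path:
  fixes c :: "nat \<Rightarrow> 'k::field"
  assumes "m \<ge> 3" "3 * q \<le> n + 1" "n < m"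
  shows "\<not> onto_at c (tadpole_edges m 2) {1..n} q"
  using assms(2,3)
proof (induction q arbitrary: n)
  case 0
  then show ?case by (simp add: not_onto_at_0)
next
  case (Suc q)
  have "\<not> onto_at c (tadpole_edges m 2) {1..n - 3} q" using Suc by auto
  moreover have "onto_at c (tadpole_edges m 2) {1..n - 3} q"
    if "onto_at c (tadpole_edges m 2) {1..n} (Suc q)"
    using that by (rule onto_at_remove_pair[where u = "n - 1" and w = n])
      (use assms(1) Suc.prems in \<open>auto simp: tadpole_loopless tadpole_edges_iff tadpole_adj_def\<close>)
  ultimately show ?case by blast
qed

text \<open>Contraction with the tail edge, whose only other neighbour is m, leaves the path 1, ...,
  m - 1, which has an induced matching of size \<open>m div 3\<close>.\<close>

lemma not_onto_at_tadpole:
  fixes c :: "nat \<Rightarrow> 'k::field"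
  assumes m: "m \<ge> 3"
  shows "\<not> onto_at c (tadpole_edges m 2) {1..m + 2} (Suc (m div 3))"
proof
  assume "onto_at c (tadpole_edges m 2) {1..m + 2} (Suc (m div 3))"
  then have "onto_at c (tadpole_edges m 2) {1..m - 1} (m div 3)"
    by (rule onto_at_remove_pair[where u = "m + 1" and w = "m + 2"])
      (use m in \<open>auto simp: tadpole_loopless tadpole_edges_iff tadpole_adj_def\<close>)
  then show False using not_onto_at_path[of m "m div 3" "m - 1" c] m by auto
qed

section \<open>Injectivity of the square of the linear form\<close>

definition square_inj_at :: "('a \<Rightarrow> 'k::comm_ring_1) \<Rightarrow> 'a set set \<Rightarrow> 'a set \<Rightarrow> nat \<Rightarrow> bool" where
  "square_inj_at c E V k \<longleftrightarrow>
     (\<forall>a. (\<forall>T\<in>indep_sets E V (Suc (Suc k)). lin_mult c (lin_mult c a) T = 0)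
       \<longrightarrow> (\<forall>S\<in>indep_sets E V k. a S = 0))"

text \<open>Adding an isolated vertex tensors A(G) with k[t]/(t^2) and replaces l by l + t. An
  element a0 + t a1 is killed only if l a0 = 0 and a0 = - l a1, hence l^2 a1 = 0.\<close>

lemma inj_at_insert_isolated:
  assumes "v \<notin> V" "{v} \<notin> E" "\<And>u. u \<in> V \<Longrightarrow> {u, v} \<notin> E" "c v = 1"
    and sq: "square_inj_at c E V k"
  shows "inj_at c E (insert v V) (Suc k)"
  unfolding inj_at_def
proof (intro allI impI ballI)
  fix a S
  assume ker: "\<forall>T\<in>indep_sets E (insert v V) (Suc (Suc k)). lin_mult c a T = 0"
    and S: "S \<in> indep_sets E (insert v V) (Suc k)"
  have away: "away E v V = V" using assms(3) by (auto simp: away_def)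
  define a1 where "a1 = (\<lambda>S. a (insert v S))"
  have a0: "a T = - lin_mult c a1 T" if T: "T \<in> indep_sets E V (Suc k)" for T
  proof -
    have "finite T" "v \<notin> T" using T assms(1) by (auto simp: indep_sets_def)
    then have "lin_mult c a (insert v T) = a T + lin_mult c a1 T"
      by (simp add: lin_mult_insert a1_def assms(4))
    moreover have "insert v T \<in> indep_sets E (insert v V) (Suc (Suc k))"
      using indep_sets_insert[of T E v V "Suc k"] T assms(1,2) away by simp
    ultimately show ?thesis using ker by (simp add: eq_neg_iff_add_eq_0)
  qed
  have "lin_mult c (lin_mult c a1) T = 0" if T: "T \<in> indep_sets E V (Suc (Suc k))" for T
  proof -
    have "lin_mult c a T = lin_mult c (\<lambda>S. - lin_mult c a1 S) T"
      using a0 indep_sets_remove[OF T] by (intro lin_mult_cong) blast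
    also have "\<dots> = - lin_mult c (lin_mult c a1) T" by (simp add: lin_mult_def sum_negf)
    finally show ?thesis using ker indep_sets_mono[of V "insert v V"] T by fastforce
  qed
  then have a1: "a1 S = 0" if "S \<in> indep_sets E V k" for S
    using sq that unfolding square_inj_at_def by blast
  have "a T = 0" if "T \<in> indep_sets E V (Suc k)" for T
    using a0[OF that] a1 indep_sets_remove[OF that] by (simp add: lin_mult_zero)
  moreover have "a (insert v T) = 0" if "T \<in> indep_sets E V k" for T
    using a1[OF that] by (simp add: a1_def)
  ultimately show "a S = 0"
    using S[unfolded indep_sets_split[OF assms(1,2)] away] by blast
qed

text \<open>The factor 2, here and in the next two formulas, counts the two orders in which a pair
  of elements is removed.\<close>

lemma lin_mult_square_2:
  "x \<noteq> y \<Longrightarrow> lin_mult (\<lambda>_. 1 :: 'k::comm_ring_1) (lin_mult (\<lambda>_. 1) a) {x, y} = 2 * a {}"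
  by (simp add: lin_mult_def insert_Diff_if)

lemma lin_mult_square_3:
  "x \<noteq> y \<Longrightarrow> x \<noteq> z \<Longrightarrow> y \<noteq> z \<Longrightarrow>
    lin_mult (\<lambda>_. 1 :: 'k::comm_ring_1) (lin_mult (\<lambda>_. 1) a) {x, y, z} = 2 * (a {x} + a {y} + a {z})"
  by (simp add: lin_mult_def insert_Diff_if algebra_simps)

lemma lin_mult_square_4:
  assumes "distinct [x, y, z, w]"
  shows "lin_mult (\<lambda>_. 1 :: 'k::comm_ring_1) (lin_mult (\<lambda>_. 1) a) {x, y, z, w}
    = 2 * (a {x, y} + a {x, z} + a {x, w} + a {y, z} + a {y, w} + a {z, w})"
proof -
  have "x \<noteq> y" "x \<noteq> z" "x \<noteq> w" "y \<noteq> z" "y \<noteq> w" "z \<noteq> w" using assms by auto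
  then show ?thesis by (simp add: lin_mult_def insert_Diff_if algebra_simps)
qed

lemma indep_sets_1_iff:
  assumes "\<And>v. {v} \<notin> E"
  shows "S \<in> indep_sets E V (Suc 0) \<longleftrightarrow> (\<exists>v\<in>V. S = {v})"
  using assms by (auto simp: indep_sets_def card_1_singleton_iff)

lemma square_inj_at_pair:
  assumes "x \<noteq> y" "indep_set E {x, y}"
  shows "square_inj_at (\<lambda>_. 1 :: 'k::field_char_0) E {x, y} 0"
  unfolding square_inj_at_def
proof (intro allI impI)
  fix a :: "'a set \<Rightarrow> 'k"
  assume "\<forall>T\<in>indep_sets E {x, y} (Suc (Suc 0)). lin_mult (\<lambda>_. 1) (lin_mult (\<lambda>_. 1) a) T = 0"
  moreover have "{x, y} \<in> indep_sets E {x, y} (Suc (Suc 0))"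
    using assms by (auto simp: indep_sets_def indep_set_def)
  ultimately show "\<forall>S\<in>indep_sets E {x, y} 0. a S = 0"
    using lin_mult_square_2[OF assms(1), of a] by auto
qed

lemma square_inj_at_four:
  assumes "distinct [x, y, z, w]" and indep: "indep_set E {x, y, z, w}"
  shows "square_inj_at (\<lambda>_. 1 :: 'k::field_char_0) E {x, y, z, w} (Suc 0)"
  unfolding square_inj_at_def
proof (intro allI impI ballI)
  fix a :: "'a set \<Rightarrow> 'k" and S
  assume ker: "\<forall>T\<in>indep_sets E {x, y, z, w} (Suc (Suc (Suc 0))).
      lin_mult (\<lambda>_. 1) (lin_mult (\<lambda>_. 1) a) T = 0"
    and S: "S \<in> indep_sets E {x, y, z, w} (Suc 0)"
  have triple: "a {p} + a {q} + a {r} = 0"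
    if "p \<noteq> q" "p \<noteq> r" "q \<noteq> r" "{p, q, r} \<subseteq> {x, y, z, w}" for p q r
  proof -
    have "{p, q, r} \<in> indep_sets E {x, y, z, w} (Suc (Suc (Suc 0)))"
      using that indep_set_subset[OF indep that(4)] by (simp add: indep_sets_def indep_set_def)
    then have "2 * (a {p} + a {q} + a {r}) = 0"
      using ker unfolding lin_mult_square_3[OF that(1-3), of a, symmetric] by blast
    then show ?thesis by (simp del: distrib_left_numeral)
  qed
  have zero: "a {p} = 0" if "distinct [p, q, r, s]" "{p, q, r, s} \<subseteq> {x, y, z, w}" for p q r s
  proof -
    \<comment> \<open>The three triples through \<open>p\<close> contain each other point twice,
      which the fourth triple corrects; characteristic zero allows division by 3.\<close>
    have "3 * a {p} = (a {p} + a {q} + a {r}) + (a {p} + a {q} + a {s}) + (a {p} + a {r} + a {s})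
        - 2 * (a {q} + a {r} + a {s})"
      by (simp add: algebra_simps)
    also have "\<dots> = 0" using that by (simp add: triple)
    finally show ?thesis by simp
  qed
  obtain p where "S = {p}" "p \<in> {x, y, z, w}" using S by (auto simp: indep_sets_def card_1_singleton_iff)
  then show "a S = 0"
    using zero[of x y z w] zero[of y x z w] zero[of z x y w] zero[of w x y z] assms(1) by auto
qed

section \<open>The square of the linear form on the cycles of length 7 and 11\<close>

text \<open>Any natural number serves as an index around the cycle, so a rotation is a shift of the
  index and one identity covers all rotations.\<close>

definition cycle_vertex :: "nat \<Rightarrow> nat \<Rightarrow> nat" where
  "cycle_vertex m i = i mod m + 1"

text \<open>The difference of the indices lies between 2 and m - 2, so whether or not it passes the
  end of the cycle, the vertices are neither equal nor neighbours.\<close>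

lemma cycle_vertex_far:
  assumes "m \<ge> 3" "i + 2 \<le> j" "j + 2 \<le> i + m"
  shows "cycle_vertex m i \<noteq> cycle_vertex m j" "\<not> tadpole_adj m (cycle_vertex m i) (cycle_vertex m j)"
    "\<not> tadpole_adj m (cycle_vertex m j) (cycle_vertex m i)"
proof -
  define r d where "r = i mod m" and "d = j - i"
  have r: "r < m" "i mod m = r" using assms(1) by (simp_all add: r_def)
  have "j = i + d" using assms(2) by (simp add: d_def)
  then have "j mod m = (r + d) mod m" by (simp add: r_def mod_add_left_eq)
  also have "\<dots> = (if r + d < m then r + d else r + d - m)"
    using r assms d_def by (simp add: mod_if)
  finally have j: "j mod m = (if r + d < m then r + d else r + d - m)" .
  have "2 \<le> d" "d + 2 \<le> m" using assms by (auto simp: d_def)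
  then show "cycle_vertex m i \<noteq> cycle_vertex m j"
    "\<not> tadpole_adj m (cycle_vertex m i) (cycle_vertex m j)"
    "\<not> tadpole_adj m (cycle_vertex m j) (cycle_vertex m i)"
    using r j assms(1) by (auto simp: cycle_vertex_def tadpole_adj_def)
qed

lemma cycle_vertex_range: "m \<ge> 3 \<Longrightarrow> cycle_vertex m i \<in> {1..m}"
  using mod_less_divisor[of m i] by (auto simp: cycle_vertex_def Suc_le_eq simp del: mod_less_divisor)

lemma cycle_vertex_surj: "v \<in> {1..m} \<Longrightarrow> v = cycle_vertex m (v - 1)"
  by (auto simp: cycle_vertex_def)

lemma cycle_vertex_add: "cycle_vertex m (i + m) = cycle_vertex m i"
  by (simp add: cycle_vertex_def)

text \<open>Gaps of at least 2 between consecutive indices, including the gap from \<open>k\<close>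
  back to \<open>i + m\<close>, imply the distance condition for all pairs.\<close>

lemma cycle_triple_indep:
  assumes "m \<ge> 3" "i + 2 \<le> j" "j + 2 \<le> k" "k + 2 \<le> i + m"
  shows "{cycle_vertex m i, cycle_vertex m j, cycle_vertex m k}
      \<in> indep_sets (tadpole_edges m 2) {1..m} (Suc (Suc (Suc 0)))"
    "cycle_vertex m i \<noteq> cycle_vertex m j" "cycle_vertex m i \<noteq> cycle_vertex m k"
    "cycle_vertex m j \<noteq> cycle_vertex m k"
proof -
  note far = cycle_vertex_far[of m i j] cycle_vertex_far[of m i k] cycle_vertex_far[of m j k]
  show "cycle_vertex m i \<noteq> cycle_vertex m j" "cycle_vertex m i \<noteq> cycle_vertex m k"
    "cycle_vertex m j \<noteq> cycle_vertex m k"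
    using far assms by auto
  then show "{cycle_vertex m i, cycle_vertex m j, cycle_vertex m k}
      \<in> indep_sets (tadpole_edges m 2) {1..m} (Suc (Suc (Suc 0)))"
    using far assms cycle_vertex_range[OF assms(1)] tadpole_adj_irrefl[OF assms(1)]
    by (simp add: indep_sets_def tadpole_edges_iff)
qed

lemma cycle_quadruple_indep:
  assumes "m \<ge> 3" "i + 2 \<le> j" "j + 2 \<le> k" "k + 2 \<le> l" "l + 2 \<le> i + m"
  shows "{cycle_vertex m i, cycle_vertex m j, cycle_vertex m k, cycle_vertex m l}
      \<in> indep_sets (tadpole_edges m 2) {1..m} (Suc (Suc (Suc (Suc 0))))"
    "distinct [cycle_vertex m i, cycle_vertex m j, cycle_vertex m k, cycle_vertex m l]"
proof -
  note far = cycle_vertex_far[of m i j] cycle_vertex_far[of m i k] cycle_vertex_far[of m j k]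
    cycle_vertex_far[of m i l] cycle_vertex_far[of m j l] cycle_vertex_far[of m k l]
  show "distinct [cycle_vertex m i, cycle_vertex m j, cycle_vertex m k, cycle_vertex m l]"
    using far assms by auto
  then show "{cycle_vertex m i, cycle_vertex m j, cycle_vertex m k, cycle_vertex m l}
      \<in> indep_sets (tadpole_edges m 2) {1..m} (Suc (Suc (Suc (Suc 0))))"
    using far assms cycle_vertex_range[OF assms(1)] tadpole_adj_irrefl[OF assms(1)]
    by (simp add: indep_sets_def tadpole_edges_iff)
qed

text \<open>The integer combinations in the next two proofs solve the linear system that expresses a
  multiple of a single coefficient by the coefficients of the product.\<close>
lemma square_inj_at_cycle_7:
  "square_inj_at (\<lambda>_. 1 :: 'k::field_char_0) (tadpole_edges 7 2) {1..7} (Suc 0)"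
  unfolding square_inj_at_def
proof (intro allI impI ballI)
  fix a :: "nat set \<Rightarrow> 'k" and S
  assume ker: "\<forall>T\<in>indep_sets (tadpole_edges 7 2) {1..7} (Suc (Suc (Suc 0))).
      lin_mult (\<lambda>_. 1) (lin_mult (\<lambda>_. 1) a) T = 0"
    and S: "S \<in> indep_sets (tadpole_edges 7 2) {1..7} (Suc 0)"
  define x where "x i = a {cycle_vertex 7 i}" for i
  have triple: "x i + x j + x k = 0" if "i + 2 \<le> j" "j + 2 \<le> k" "k + 2 \<le> i + 7" for i j k
  proof -
    have "(3::nat) \<le> 7" by simp
    note indep = cycle_triple_indep[OF this that]
    have "2 * (x i + x j + x k) = 0"
      using ker indep(1) unfolding x_def lin_mult_square_3[OF indep(2-4), of a, symmetric] by blast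
    then show ?thesis by (simp del: distrib_left_numeral)
  qed
  have "x i = 0" for i
  proof -
    define F where "F p q r = x (i + p) + x (i + q) + x (i + r)" for p q r
    have "3 * x i = F 0 2 4 + F 0 2 5 + F 0 3 5 - 2 * F 1 3 5 + F 1 3 6 + F 1 4 6 - 2 * F 2 4 6"
      by (simp add: F_def algebra_simps)
    also have "\<dots> = 0" by (simp add: F_def triple del: One_nat_def)
    finally show ?thesis by simp
  qed
  moreover obtain v where "S = {v}" "v \<in> {1..7}"
    using S by (auto simp: indep_sets_1_iff tadpole_loopless)
  ultimately show "a S = 0" using cycle_vertex_surj[of v 7] unfolding x_def by metis
qed

lemma square_inj_at_cycle_11:
  "square_inj_at (\<lambda>_. 1 :: 'k::field_char_0) (tadpole_edges 11 2) {1..11} 2"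
  unfolding square_inj_at_def
proof (intro allI impI ballI)
  fix a :: "nat set \<Rightarrow> 'k" and S
  assume ker: "\<forall>T\<in>indep_sets (tadpole_edges 11 2) {1..11} (Suc (Suc 2)).
      lin_mult (\<lambda>_. 1) (lin_mult (\<lambda>_. 1) a) T = 0"
    and S: "S \<in> indep_sets (tadpole_edges 11 2) {1..11} 2"
  define x where "x i j = a {cycle_vertex 11 i, cycle_vertex 11 j}" for i j
  have wrap: "x i j = x j (i + 11)" for i j
    by (simp add: x_def cycle_vertex_add insert_commute)
  define f where "f i j k l = x i j + x i k + x i l + x j k + x j l + x k l" for i j k l
  have f: "f i j k l = 0" if "i + 2 \<le> j" "j + 2 \<le> k" "k + 2 \<le> l" "l + 2 \<le> i + 11" for i j k l
  proof -
    have "(3::nat) \<le> 11" by simp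
    note indep = cycle_quadruple_indep[OF this that]
    have "2 * f i j k l = 0"
      using ker indep(1) unfolding f_def x_def lin_mult_square_4[OF indep(2), of a, symmetric]
        numeral_2_eq_2 by blast
    then show ?thesis by simp
  qed
  \<comment> \<open>The cyclic distances are eliminated in the order 3, 2, 4, 5, each identity using
    the zeros found before it. Through \<open>wrap\<close>, distance d also settles 11 - d, so all
    differences from 2 to 9 are reached.\<close>
  have d3: "x i (i + 3) = 0" for i
  proof -
    define F where "F p q r s = f (i + p) (i + q) (i + r) (i + s)" for p q r s
    have "6 * x i (i + 3) =
      F 0 2 4 6 + F 0 2 4 7 + F 0 2 4 9 - F 0 2 5 7 - F 0 2 6 9 - F 0 2 7 9 + F 0 3 5 7
      + F 0 3 5 8 + F 0 3 6 8 + 2 * F 0 3 6 9 + F 0 3 7 9 - 2 * F 0 4 6 8 - F 0 4 6 9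
      - F 0 5 7 9 - F 1 3 5 7 - F 1 3 5 9 + F 1 3 5 10 - F 1 3 7 9 + F 1 3 7 10
      + F 1 3 8 10 + F 1 4 6 8 - F 1 4 7 10 + 2 * F 1 5 7 9 - F 1 5 8 10 - F 1 6 8 10
      - F 2 4 6 8 - F 2 4 6 10 - F 2 4 8 10 + F 2 5 7 9 + 2 * F 2 6 8 10 - F 3 5 7 9
      - 3 * F 3 6 8 10 + 3 * F 4 6 8 10"
      by (simp add: F_def f_def algebra_simps)
    also have "\<dots> = 0" by (simp add: F_def f del: One_nat_def)
    finally show ?thesis by simp
  qed
  have d3': "x (i + p) (i + q) = 0" if "q = p + 3 \<or> q = p + 8" for i p q
    using d3[of "i + p"] d3[of "i + q"] wrap[of "i + p" "i + q"] that by (auto simp: ac_simps)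
  have d2: "x i (i + 2) = 0" for i
  proof -
    define F where "F p q r s = f (i + p) (i + q) (i + r) (i + s)" for p q r s
    have "3 * x i (i + 2) =
      F 0 2 5 7 + F 0 2 5 9 + F 0 2 7 9 - F 0 3 5 7 - F 0 3 5 9 - F 0 3 7 9 - 2 * F 2 5 7 9
      + 2 * F 3 5 7 9"
      by (simp add: F_def f_def d3' d3'[where p = 0, simplified] del: One_nat_def)
    also have "\<dots> = 0" by (simp add: F_def f del: One_nat_def)
    finally show ?thesis by simp
  qed
  have d2': "x (i + p) (i + q) = 0" if "q = p + 2 \<or> q = p + 9" for i p q
    using d2[of "i + p"] d2[of "i + q"] wrap[of "i + p" "i + q"] that by (auto simp: ac_simps)
  have d4: "x i (i + 4) = 0" for i
  proof -
    define F where "F p q r s = f (i + p) (i + q) (i + r) (i + s)" for p q r s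
    have "x i (i + 4) =
      - F 0 3 6 9 + F 0 4 6 9 + F 1 3 6 9 - F 1 4 6 9"
      by (simp add: F_def f_def d3' d2' d3'[where p = 0, simplified] d2'[where p = 0, simplified] del: One_nat_def)
    also have "\<dots> = 0" by (simp add: F_def f del: One_nat_def)
    finally show ?thesis by simp
  qed
  have d4': "x (i + p) (i + q) = 0" if "q = p + 4 \<or> q = p + 7" for i p q
    using d4[of "i + p"] d4[of "i + q"] wrap[of "i + p" "i + q"] that by (auto simp: ac_simps)
  have d5: "x i (i + 5) = 0" for i
  proof -
    have "x i (i + 5) = f i (i + 3) (i + 5) (i + 7)"
      by (simp add: f_def d3' d2' d4' d3'[where p = 0, simplified] d2'[where p = 0, simplified] d4'[where p = 0, simplified] del: One_nat_def)
    also have "\<dots> = 0" by (simp add: f)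
    finally show ?thesis by simp
  qed
  have d5': "x (i + p) (i + q) = 0" if "q = p + 5 \<or> q = p + 6" for i p q
    using d5[of "i + p"] d5[of "i + q"] wrap[of "i + p" "i + q"] that by (auto simp: ac_simps)
  have zero: "a {u, v} = 0"
    if uv: "u < v" "u \<in> {1..11}" "v \<in> {1..11}" "{u, v} \<notin> tadpole_edges 11 2" for u v
  proof -
    define d where "d = v - u"
    have v: "v = u + d" using uv(1) by (simp add: d_def)
    have "d \<noteq> 1" "d \<noteq> 10" using uv by (auto simp: v tadpole_edges_iff tadpole_adj_def)
    moreover have "0 < d" "d \<le> 10" using uv by (auto simp: v)
    ultimately have "d = 2 \<or> d = 3 \<or> d = 4 \<or> d = 5 \<or> d = 6 \<or> d = 7 \<or> d = 8 \<or> d = 9"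
      by presburger
    then have "x (u - 1 + 0) (u - 1 + d) = 0"
      using d2'[of d 0 "u - 1"] d3'[of d 0 "u - 1"] d4'[of d 0 "u - 1"] d5'[of d 0 "u - 1"] by auto
    moreover have "u = cycle_vertex 11 (u - 1 + 0)" "v = cycle_vertex 11 (u - 1 + d)"
      using cycle_vertex_surj[of u 11] cycle_vertex_surj[of v 11] uv by (auto simp: v)
    ultimately show ?thesis unfolding x_def by metis
  qed
  obtain u v where "S = {u, v}" "u \<noteq> v" "S \<subseteq> {1..11}" "{u, v} \<notin> tadpole_edges 11 2"
    using S by (auto simp: indep_sets_def card_2_iff)
  then show "a S = 0"
    using zero[of u v] zero[of v u] by (cases "u < v") (auto simp: insert_commute)
qed

section \<open>Certifying injectivity and surjectivity by successive vertex removal\<close>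

definition indep_list :: "('a \<Rightarrow> 'a \<Rightarrow> bool) \<Rightarrow> 'a list \<Rightarrow> bool" where
  "indep_list adj xs \<longleftrightarrow> list_all (\<lambda>x. list_all (\<lambda>y. \<not> adj x y) xs) xs"

text \<open>A certificate along a vertex order: the head is removed as in
  \<open>onto_at_insert\<close>, with target degree \<open>k - 1\<close> on its non-neighbours.
  Three independent vertices form a separate leaf, since their map from degree 1 to degree 2 is
  bijective while removing a vertex leads to a failing instance. Success covers all target degrees
  from \<open>k\<close> upwards.\<close>

fun onto_check :: "('a \<Rightarrow> 'a \<Rightarrow> bool) \<Rightarrow> 'a list \<Rightarrow> nat \<Rightarrow> bool" where
  "onto_check adj [] k = (k \<noteq> 0)"
| "onto_check adj (v # vs) k = (k \<noteq> 0 \<and>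
     (vs = [] \<or> (2 \<le> k \<and> length vs = 2 \<and> indep_list adj (v # vs)) \<or>
      (onto_check adj vs k \<and> onto_check adj (filter (\<lambda>u. \<not> adj u v) vs) (k - 1))))"

text \<open>The analogue for \<open>inj_at_insert\<close>; success covers all degrees up to
  \<open>k\<close>. On 3 or 5 independent vertices the middle map is bijective, but on one vertex
  fewer the map from that degree is no longer injective; hence these two leaves.\<close>

fun inj_check :: "('a \<Rightarrow> 'a \<Rightarrow> bool) \<Rightarrow> 'a list \<Rightarrow> nat \<Rightarrow> bool" where
  "inj_check adj [] k = False"
| "inj_check adj (v # vs) k = (k = 0 \<or>
     (k \<le> 1 \<and> length vs = 2 \<and> indep_list adj (v # vs)) \<or>
     (k \<le> 2 \<and> length vs = 4 \<and> indep_list adj (v # vs)) \<or>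
      (inj_check adj vs k \<and> inj_check adj (filter (\<lambda>u. \<not> adj u v) vs) (k - 1)))"

lemma away_set:
  assumes "\<And>u v. {u, v} \<in> E \<longleftrightarrow> adj u v"
  shows "away E v (set vs) = set (filter (\<lambda>u. \<not> adj u v) vs)"
  using assms by (auto simp: away_def)

lemma indep_list_iff:
  assumes "\<And>u v. {u, v} \<in> E \<longleftrightarrow> adj u v"
  shows "indep_list adj xs \<longleftrightarrow> indep_set E (set xs)"
  by (auto simp: assms indep_set_def indep_list_def list_all_iff)

lemma onto_at_singleton:
  assumes "c v = 1" "k \<noteq> 0"
  shows "onto_at c E {v} k"
  unfolding onto_at_def
proof (intro allI exI ballI)
  fix b T assume "T \<in> indep_sets E {v} k"
  then have "T = {v}" using assms(2) by (auto simp: indep_sets_def subset_singleton_iff)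
  then show "lin_mult c (\<lambda>_. b {v}) T = b T" by (simp add: lin_mult_def assms(1))
qed

text \<open>With \<open>x\<close> split off as an isolated vertex, this becomes injectivity of the
  square on two vertices, which is multiplication by 2.\<close>

lemma inj_at_1_triple:
  assumes xyz: "distinct [x, y, z]" and indep: "indep_set E {x, y, z}"
  shows "inj_at (\<lambda>_. 1 :: 'k::field_char_0) E {x, y, z} (Suc 0)"
proof (rule inj_at_insert_isolated)
  show "square_inj_at (\<lambda>_. 1 :: 'k) E {y, z} 0"
    using xyz by (intro square_inj_at_pair indep_set_subset[OF indep]) auto
  show "{x} \<notin> E" by (rule indep_set_loopless[OF indep]) simp
  show "{u, x} \<notin> E" if "u \<in> {y, z}" for u using that by (intro indep_setD[OF indep]) auto
qed (use xyz in simp_all)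

lemma onto_at_pair:
  assumes "x \<noteq> y" and indep: "indep_set E {x, y}" and "k \<ge> 2"
  shows "onto_at (\<lambda>_. 1 :: 'k::comm_ring_1) E {x, y} k"
proof -
  obtain j where k: "k = Suc j" "j \<noteq> 0" using assms(3) by (cases k) auto
  have "away E x {y} = {y}" by (rule away_indep_set[OF indep]) auto
  moreover have "{x} \<notin> E" by (rule indep_set_loopless[OF indep]) simp
  ultimately show ?thesis unfolding k(1)
    by (intro onto_at_insert[of x "{y}"]) (use assms(1) k(2) in \<open>simp_all add: onto_at_singleton\<close>)
qed

text \<open>For \<open>k = 2\<close> source and target both have dimension 3, so injectivity
  suffices; higher degrees follow by removing a vertex.\<close>

lemma onto_at_triple:
  assumes xyz: "distinct [x, y, z]" and indep: "indep_set E {x, y, z}" and "k \<ge> 2"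
  shows "onto_at (\<lambda>_. 1 :: 'k::field_char_0) E {x, y, z} k"
proof (cases "k = 2")
  case True
  have "card (indep_sets E {x, y, z} (Suc k)) =
      card (indep_sets E {y, z} (Suc k)) + card (indep_sets E {y, z} k)"
    "card (indep_sets E {y, z} (Suc k)) = card (indep_sets E {z} (Suc k)) + card (indep_sets E {z} k)"
    "card (indep_sets E {z} (Suc k)) = card (indep_sets E {} (Suc k)) + card (indep_sets E {} k)" for k
    using xyz
    by (intro card_indep_sets_insert_isolated indep_setD[OF indep] indep_set_loopless[OF indep]; auto)+
  then have "card (indep_sets E {x, y, z} (Suc (Suc 0))) \<le> card (indep_sets E {x, y, z} (Suc 0))"
    by simp
  then show ?thesis
    unfolding True numeral_2_eq_2 using inj_at_1_triple[OF xyz indep] by (intro onto_at_if_inj_at) auto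
next
  case False
  then obtain j where k: "k = Suc j" "j \<ge> 2" using assms(3) by (cases k) auto
  have "away E x {y, z} = {y, z}" by (rule away_indep_set[OF indep]) auto
  moreover have "{x} \<notin> E" by (rule indep_set_loopless[OF indep]) simp
  moreover have "onto_at (\<lambda>_. 1 :: 'k) E {y, z} i" if "i \<ge> 2" for i
    using xyz that by (intro onto_at_pair indep_set_subset[OF indep]) auto
  ultimately show ?thesis unfolding k(1)
    by (intro onto_at_insert[of x "{y, z}"]) (use xyz k(2) in simp_all)
qed

text \<open>Degree 1 follows by removing vertices down to three. Degree 2 uses one isolated vertex
  and the square on the other four.\<close>

lemma inj_at_quintuple:
  assumes dist: "distinct [x, y, z, w, v]" and indep: "indep_set E {x, y, z, w, v}" and "k \<le> 2"
  shows "inj_at (\<lambda>_. 1 :: 'k::field_char_0) E {x, y, z, w, v} k"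
proof -
  let ?I = "\<lambda>V k. inj_at (\<lambda>_. 1 :: 'k) E V k"
  note loopless = indep_set_loopless[OF indep]
  have 0: "?I V 0" if "p \<in> V" "V \<subseteq> {x, y, z, w, v}" for p V
    using that loopless[of p] by (intro inj_at_0[of p]) auto
  have "?I {y, z, w, v} (Suc 0)"
  proof (rule inj_at_insert)
    show "?I {z, w, v} (Suc 0)"
      using dist by (intro inj_at_1_triple indep_set_subset[OF indep]) auto
    have "away E y {z, w, v} = {z, w, v}" by (rule away_indep_set[OF indep]) auto
    then show "?I (away E y {z, w, v}) 0" using 0[of z] by simp
  qed (use dist loopless in simp_all)
  then have 1: "?I {x, y, z, w, v} (Suc 0)"
  proof (rule inj_at_insert[rotated 2])
    have "away E x {y, z, w, v} = {y, z, w, v}" by (rule away_indep_set[OF indep]) auto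
    then show "?I (away E x {y, z, w, v}) 0" using 0[of z] by simp
  qed (use dist loopless in simp_all)
  have 2: "?I {x, y, z, w, v} (Suc (Suc 0))"
  proof (rule inj_at_insert_isolated)
    show "square_inj_at (\<lambda>_. 1 :: 'k) E {y, z, w, v} (Suc 0)"
      using dist by (intro square_inj_at_four indep_set_subset[OF indep]) auto
    show "{u, x} \<notin> E" if "u \<in> {y, z, w, v}" for u using that by (intro indep_setD[OF indep]) auto
  qed (use dist loopless in simp_all)
  have "k = 0 \<or> k = Suc 0 \<or> k = Suc (Suc 0)" using assms(3) by auto
  then show ?thesis using 0[of x "{x, y, z, w, v}"] 1 2 by auto
qed

text \<open>Induction on the length, because one recursive call is on a filtered tail. The degree
  \<open>k'\<close> is kept separate from \<open>k\<close>, as both drop by one on the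
  non-neighbours.\<close>

lemma onto_check_sound:
  assumes adj: "\<And>u v. {u, v} \<in> E \<longleftrightarrow> adj u v" and loopless: "\<And>v. {v} \<notin> E"
  shows "onto_check adj vs k \<Longrightarrow> distinct vs \<Longrightarrow> k \<le> k' \<Longrightarrow>
    onto_at (\<lambda>_. 1 :: 'k::field_char_0) E (set vs) k'"
proof (induction vs arbitrary: k k' rule: length_induct)
  case (1 vs)
  show ?case
  proof (cases vs)
    case Nil
    then show ?thesis using 1(2,4) by (cases k') (auto simp: onto_at_empty)
  next
    case (Cons v us)
    obtain j where k': "k' = Suc j" using 1(2,4) Cons by (cases k') auto
    consider "us = []" | "2 \<le> k" "length us = 2" "indep_list adj (v # us)"
      | "onto_check adj us k" "onto_check adj (filter (\<lambda>u. \<not> adj u v) us) (k - 1)"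
      using 1(2) unfolding Cons by auto
    then show ?thesis
    proof cases
      case 1
      then show ?thesis using Cons k' by (simp add: onto_at_singleton)
    next
      case 2
      then obtain x y where us: "us = [x, y]" by (auto simp: length_Suc_conv numeral_2_eq_2)
      have "onto_at (\<lambda>_. 1 :: 'k) E {v, x, y} k'"
        by (rule onto_at_triple)
          (use 1(3,4) 2(1,3) in \<open>simp_all add: Cons us indep_list_iff[OF adj]\<close>)
      then show ?thesis by (simp add: Cons us)
    next
      case 3
      have "onto_at (\<lambda>_. 1 :: 'k) E (set us) (Suc j)"
        using 1(1)[rule_format, of us k "Suc j"] 1(3,4) 3(1) Cons k' by simp
      moreover have "onto_at (\<lambda>_. 1 :: 'k) E (away E v (set us)) j"
        unfolding away_set[OF adj]
        using 1(1)[rule_format, of "filter (\<lambda>u. \<not> adj u v) us" "k - 1" j] 1(3,4) 3(2) Cons k'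
        by (simp add: le_imp_less_Suc)
      ultimately show ?thesis
        unfolding Cons k' using onto_at_insert[of v "set us" E] 1(3) Cons loopless by simp
    qed
  qed
qed

lemma inj_check_sound:
  assumes adj: "\<And>u v. {u, v} \<in> E \<longleftrightarrow> adj u v" and loopless: "\<And>v. {v} \<notin> E"
  shows "inj_check adj vs k \<Longrightarrow> distinct vs \<Longrightarrow> k' \<le> k \<Longrightarrow>
    inj_at (\<lambda>_. 1 :: 'k::field_char_0) E (set vs) k'"
proof (induction vs arbitrary: k k' rule: length_induct)
  case (1 vs)
  show ?case
  proof (cases vs)
    case Nil
    then show ?thesis using 1(2) by simp
  next
    case (Cons v us)
    show ?thesis
    proof (cases k')
      case 0
      then show ?thesis using inj_at_0[of v "set vs" E "\<lambda>_. 1"] loopless Cons by simp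
    next
      case (Suc j)
      consider "k \<le> 1" "length us = 2" "indep_list adj (v # us)"
        | "k \<le> 2" "length us = 4" "indep_list adj (v # us)"
        | "inj_check adj us k" "inj_check adj (filter (\<lambda>u. \<not> adj u v) us) (k - 1)"
        using 1(2,4) Suc unfolding Cons by auto
      then show ?thesis
      proof cases
        case 1
        then obtain x y where us: "us = [x, y]" by (auto simp: length_Suc_conv numeral_2_eq_2)
        have "k' = Suc 0" using Suc 1(1) \<open>k' \<le> k\<close> by simp
        moreover have "inj_at (\<lambda>_. 1 :: 'k) E {v, x, y} (Suc 0)"
          by (rule inj_at_1_triple)
            (use \<open>distinct vs\<close> 1(3) in \<open>simp_all add: Cons us indep_list_iff[OF adj]\<close>)
        ultimately show ?thesis by (simp add: Cons us)
      next
        case 2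
        then obtain x y z w where us: "us = [x, y, z, w]"
          by (auto simp: length_Suc_conv eval_nat_numeral)
        have "inj_at (\<lambda>_. 1 :: 'k) E {v, x, y, z, w} k'"
          by (rule inj_at_quintuple)
            (use \<open>distinct vs\<close> \<open>k' \<le> k\<close> 2(1,3) in \<open>simp_all add: Cons us indep_list_iff[OF adj]\<close>)
        then show ?thesis by (simp add: Cons us)
      next
        case 3
        have "inj_at (\<lambda>_. 1 :: 'k) E (set us) (Suc j)"
          using 1(1)[rule_format, of us k "Suc j"] 1(3,4) 3(1) Cons Suc by simp
        moreover have "inj_at (\<lambda>_. 1 :: 'k) E (away E v (set us)) j"
          unfolding away_set[OF adj]
          using 1(1)[rule_format, of "filter (\<lambda>u. \<not> adj u v) us" "k - 1" j] 1(3,4) 3(2) Cons Suc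
          by (simp add: le_imp_less_Suc)
        ultimately show ?thesis
          unfolding Cons Suc using inj_at_insert[of v "set us" E] 1(3) Cons loopless by simp
      qed
    qed
  qed
qed

section \<open>Tadpole graphs with the weak Lefschetz property\<close>

lemma tadpole_onto_at_check:
  assumes "m \<ge> 3" "onto_check (tadpole_adj m) vs k \<and> distinct vs \<and> set vs = {1..m + 2}" "k \<le> k'"
  shows "onto_at (\<lambda>_. 1 :: 'k::field_char_0) (tadpole_edges m 2) {1..m + 2} k'"
  using onto_check_sound[of "tadpole_edges m 2" "tadpole_adj m" vs k k'] assms
  by (simp add: tadpole_edges_iff tadpole_loopless)

lemma tadpole_inj_at_check:
  assumes "m \<ge> 3" "inj_check (tadpole_adj m) vs k \<and> distinct vs \<and> set vs = V" "k' \<le> k"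
  shows "inj_at (\<lambda>_. 1 :: 'k::field_char_0) (tadpole_edges m 2) V k'"
  using inj_check_sound[of "tadpole_edges m 2" "tadpole_adj m" vs k k'] assms
  by (simp add: tadpole_edges_iff tadpole_loopless)

text \<open>Removing m + 1 leaves the cycle with m + 2 isolated, where the square on the cycle
  decides; the non-neighbours of m + 1 form the path 1, ..., m - 1.\<close>

lemma tadpole_inj_at_if_square_inj_at_cycle:
  assumes m: "m \<ge> 3"
    and cycle: "square_inj_at (\<lambda>_. 1 :: 'k::field_char_0) (tadpole_edges m 2) {1..m} k"
    and path: "inj_at (\<lambda>_. 1 :: 'k) (tadpole_edges m 2) {1..m - 1} k"
  shows "inj_at (\<lambda>_. 1 :: 'k) (tadpole_edges m 2) {1..m + 2} (Suc k)"
proof -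
  let ?E = "tadpole_edges m 2"
  have V: "{1..m + 2} = insert (m + 1) (insert (m + 2) {1..m})" by auto
  have away: "away ?E (m + 1) (insert (m + 2) {1..m}) = {1..m - 1}"
    using m by (auto simp: away_def tadpole_edges_iff tadpole_adj_def)
  have "inj_at (\<lambda>_. 1 :: 'k) ?E (insert (m + 2) {1..m}) (Suc k)"
    by (rule inj_at_insert_isolated[OF _ _ _ _ cycle])
      (use m in \<open>auto simp: tadpole_loopless tadpole_edges_iff tadpole_adj_def\<close>)
  then show ?thesis
    unfolding V using path away by (intro inj_at_insert[of "m + 1"]) (simp_all add: tadpole_loopless m)
qed

section \<open>Failure of injectivity and of the weak Lefschetz property\<close>

lemma card_indep_sets_1:
  assumes "\<And>v. {v} \<notin> E"
  shows "card (indep_sets E V (Suc 0)) = card V"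
proof -
  have "indep_sets E V (Suc 0) = (\<lambda>v. {v}) ` V"
    using indep_sets_1_iff[OF assms] by auto
  then show ?thesis by (simp add: card_image)
qed

text \<open>From 27 on the quotient \<open>m div 3\<close> is at least 9 and the general estimate
  applies; the smaller values are computed. The excluded values are those \<open>m \<ge> 6\<close>
  where the dimension grows from degree \<open>m div 3\<close> to the next.\<close>

lemma tadpole_count_decreasing:
  assumes "m \<ge> 6" "m \<notin> {7, 8, 11, 14}"
  shows "tadpole_count m (m div 3 - 1) \<le> tadpole_count m (m div 3 - 2)"
proof (cases "m \<ge> 27")
  case True
  then have "m div 3 \<ge> 9" "m mod 3 \<le> 2" by auto
  then show ?thesis using tadpole_count_decreasing_large[of "m div 3" "m mod 3"] by simp
next
  case False
  then have "m = 6 \<or> m = 9 \<or> m = 10 \<or> m = 12 \<or> m = 13 \<or> m = 15 \<or> m = 16 \<or> m = 17 \<or> m = 18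
      \<or> m = 19 \<or> m = 20 \<or> m = 21 \<or> m = 22 \<or> m = 23 \<or> m = 24 \<or> m = 25 \<or> m = 26"
    using assms by auto presburger
  then show ?thesis
    by (elim disjE)
      (simp_all add: tadpole_count_def binomial_code fold_atLeastAtMost_nat.simps fact_numeral
        flip: numeral_2_eq_2)
qed

text \<open>For \<open>m = 14\<close> the dimension increases from degree 4 to degree 5, but the path on 13 vertices
  together with the tail edge already accounts for a 45-dimensional cokernel.\<close>
lemma not_inj_at_tadpole_14:
  fixes c :: "nat \<Rightarrow> 'k::field"
  shows "\<not> inj_at c (tadpole_edges 14 2) {1..16} 4"
proof
  let ?E = "tadpole_edges 14 2"
  assume "inj_at c ?E {1..16} 4"
  then have "inj_at c ?E {1..16} (Suc 3)" by simp
  then have "card (indep_sets ?E {1..16} (Suc 3)) + card (indep_sets ?E {1..13} (Suc 3))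
      \<le> card (indep_sets ?E {1..16} (Suc (Suc 3))) + card (indep_sets ?E {1..13} 3)"
    by (rule inj_at_pair_card[where u = 15 and w = 16])
      (auto simp: tadpole_loopless tadpole_edges_iff tadpole_adj_def)
  moreover have "card (indep_sets ?E {1..16} (Suc 3)) = tadpole_count 14 2"
    "card (indep_sets ?E {1..16} (Suc (Suc 3))) = tadpole_count 14 3"
    using card_indep_sets_tadpole[of 14 2] card_indep_sets_tadpole[of 14 3]
    by (simp_all add: eval_nat_numeral)
  moreover have "card (indep_sets ?E {1..13} k) = (14 - k) choose k" for k
  proof -
    have "{1..13} = {1..<1 + (13::nat)}" by auto
    then show ?thesis using card_indep_sets_path[of 14 1 13 k] by simp
  qed
  ultimately show False
    by (simp add: tadpole_count_def binomial_code fold_atLeastAtMost_nat.simps fact_numeral)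
qed

text \<open>Except for 14, the target is at most as large as the source, so an injective map would
  also be onto, against \<open>not_onto_at_tadpole\<close>.\<close>

lemma not_inj_at_tadpole:
  fixes c :: "nat \<Rightarrow> 'k::field"
  assumes m: "m \<ge> 3" "m \<notin> {4, 5, 7, 8, 11}"
  shows "\<not> inj_at c (tadpole_edges m 2) {1..m + 2} (m div 3)"
proof (cases "m = 14")
  case True
  then show ?thesis using not_inj_at_tadpole_14[of c] by simp
next
  case False
  let ?E = "tadpole_edges m 2"
  have "card (indep_sets ?E {1..m + 2} (Suc (m div 3))) \<le> card (indep_sets ?E {1..m + 2} (m div 3))"
  \<comment> \<open>For \<open>m = 3\<close> the source degree is 1, below the range of
    \<open>tadpole_count\<close>.\<close>
  proof (cases "m = 3")
    case True
    have "card (indep_sets ?E {1..m + 2} (Suc (Suc 0))) = tadpole_count m 0"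
      using card_indep_sets_tadpole[OF m(1), of 0] by (simp add: numeral_2_eq_2)
    moreover have "card (indep_sets ?E {1..m + 2} (Suc 0)) = m + 2"
      using card_indep_sets_1[of ?E "{1..m + 2}"] m by (simp add: tadpole_loopless)
    ultimately show ?thesis using True by (simp add: tadpole_count_def choose_two)
  next
    case False
    then have "m \<ge> 6" using m by auto
    then have "m div 3 = (m div 3 - 2) + 2" "Suc (m div 3) = (m div 3 - 1) + 2" by auto
    then show ?thesis
      using card_indep_sets_tadpole[OF m(1), of "m div 3 - 2"] \<open>m \<noteq> 14\<close> \<open>m \<ge> 6\<close> m
        card_indep_sets_tadpole[OF m(1), of "m div 3 - 1"] tadpole_count_decreasing[of m] by simp
  qed
  then show ?thesis using onto_at_if_inj_at[of "{1..m + 2}" c ?E] not_onto_at_tadpole[OF m(1)] by auto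
qed

lemma not_WLP_tadpole:
  assumes m: "m \<ge> 3" "m \<notin> {4, 5, 7, 8, 11}"
  shows "\<not> AG_has_WLP TYPE('k::field) (m + 2) (tadpole_edges m 2)"
proof
  let ?E = "tadpole_edges m 2"
  assume "AG_has_WLP TYPE('k) (m + 2) ?E"
  then obtain c :: "nat \<Rightarrow> 'k" where c: "\<And>j. j < AG_top_degree TYPE('k) (m + 2) ?E \<Longrightarrow>
      inj_at c ?E {1..m + 2} j \<or> onto_at c ?E {1..m + 2} (Suc j)"
    using AG_has_WLP_iff[of ?E] tadpole_loopless[OF m(1)] by blast
  have not_onto: "\<not> onto_at c ?E {1..m + 2} (Suc (m div 3))" using not_onto_at_tadpole[OF m(1)] .
  \<comment> \<open>A map that is not onto has a nonzero target, so \<open>m div 3\<close> lies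
    below the top degree.\<close>
  then have "indep_sets ?E {1..m + 2} (Suc (m div 3)) \<noteq> {}" by (auto simp: onto_at_def)
  then have "Suc (m div 3) \<le> AG_top_degree TYPE('k) (m + 2) ?E"
    using le_AG_top_degree tadpole_loopless[OF m(1)] by blast
  then show False using c[of "m div 3"] not_onto not_inj_at_tadpole[OF m] by auto
qed

section \<open>The five graphs with the weak Lefschetz property\<close>

text \<open>The maps from degrees up to \<open>d\<close> are injective and the later ones onto; as
  \<open>onto_at\<close> is indexed by the target, the first of the latter has index
  \<open>d + 2\<close>.\<close>

lemma WLP_tadpole:
  assumes m: "m \<ge> 3"
    and inj: "\<And>j. j \<le> d \<Longrightarrow> inj_at (\<lambda>_. 1 :: 'k::comm_ring_1) (tadpole_edges m 2) {1..m + 2} j"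
    and onto: "\<And>k. k \<ge> d + 2 \<Longrightarrow> onto_at (\<lambda>_. 1 :: 'k) (tadpole_edges m 2) {1..m + 2} k"
  shows "AG_has_WLP TYPE('k) (m + 2) (tadpole_edges m 2)"
proof -
  have "inj_at (\<lambda>_. 1 :: 'k) (tadpole_edges m 2) {1..m + 2} j
      \<or> onto_at (\<lambda>_. 1 :: 'k) (tadpole_edges m 2) {1..m + 2} (Suc j)" for j
    using inj[of j] onto[of "Suc j"] by (cases "j \<le> d") auto
  then show ?thesis using AG_has_WLP_iff[of "tadpole_edges m 2"] tadpole_loopless[OF m] by blast
qed

text \<open>The vertex orders were found by a computer search.\<close>
lemma WLP_tadpole_4: "AG_has_WLP TYPE('k::field_char_0) (4 + 2) (tadpole_edges 4 2)"
proof (rule WLP_tadpole[where d = 1])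
  have check: "inj_check (tadpole_adj 4) [2, 4, 6, 3, 1, 5] 1
      \<and> distinct [2, 4, 6, 3, 1, 5::nat] \<and> set [2, 4, 6, 3, 1, 5] = {1..4 + 2::nat}" by code_simp
  show "inj_at (\<lambda>_. 1 :: 'k) (tadpole_edges 4 2) {1..4 + 2} j" if "j \<le> 1" for j
    by (rule tadpole_inj_at_check[OF _ check]) (use that in simp_all)
  have check: "onto_check (tadpole_adj 4) [1, 4, 5, 6, 3, 2] 3
      \<and> distinct [1, 4, 5, 6, 3, 2::nat] \<and> set [1, 4, 5, 6, 3, 2] = {1..4 + 2::nat}" by code_simp
  show "onto_at (\<lambda>_. 1 :: 'k) (tadpole_edges 4 2) {1..4 + 2} k" if "k \<ge> 1 + 2" for k
    by (rule tadpole_onto_at_check[OF _ check]) (use that in simp_all)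
qed simp

lemma WLP_tadpole_5: "AG_has_WLP TYPE('k::field_char_0) (5 + 2) (tadpole_edges 5 2)"
proof (rule WLP_tadpole[where d = 1])
  have check: "inj_check (tadpole_adj 5) [3, 6, 4, 1, 5, 7, 2] 1
      \<and> distinct [3, 6, 4, 1, 5, 7, 2::nat]
      \<and> set [3, 6, 4, 1, 5, 7, 2] = {1..5 + 2::nat}" by code_simp
  show "inj_at (\<lambda>_. 1 :: 'k) (tadpole_edges 5 2) {1..5 + 2} j" if "j \<le> 1" for j
    by (rule tadpole_inj_at_check[OF _ check]) (use that in simp_all)
  have check: "onto_check (tadpole_adj 5) [3, 5, 7, 1, 2, 6, 4] 3
      \<and> distinct [3, 5, 7, 1, 2, 6, 4::nat]
      \<and> set [3, 5, 7, 1, 2, 6, 4] = {1..5 + 2::nat}" by code_simp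
  show "onto_at (\<lambda>_. 1 :: 'k) (tadpole_edges 5 2) {1..5 + 2} k" if "k \<ge> 1 + 2" for k
    by (rule tadpole_onto_at_check[OF _ check]) (use that in simp_all)
qed simp

lemma WLP_tadpole_7: "AG_has_WLP TYPE('k::field_char_0) (7 + 2) (tadpole_edges 7 2)"
proof (rule WLP_tadpole[where d = 2])
  have check: "inj_check (tadpole_adj 7) [3, 5, 1, 6, 4, 2] 1
      \<and> distinct [3, 5, 1, 6, 4, 2::nat]
      \<and> set [3, 5, 1, 6, 4, 2] = {1..7 - 1::nat}" by code_simp
  have path: "inj_at (\<lambda>_. 1 :: 'k) (tadpole_edges 7 2) {1..7 - 1} 1"
    by (rule tadpole_inj_at_check[OF _ check]) simp_all
  \<comment> \<open>Degree 2 comes from the square on the 7-cycle in degree 1 and from the path 1,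
    ..., 6; the next certificate supplies degrees 0 and 1.\<close>
  have top: "inj_at (\<lambda>_. 1 :: 'k) (tadpole_edges 7 2) {1..7 + 2} (Suc 1)"
    by (rule tadpole_inj_at_if_square_inj_at_cycle[OF _ _ path]) (simp_all add: square_inj_at_cycle_7[simplified])
  have check: "inj_check (tadpole_adj 7) [6, 9, 8, 1, 4, 3, 2, 5, 7] 1
      \<and> distinct [6, 9, 8, 1, 4, 3, 2, 5, 7::nat]
      \<and> set [6, 9, 8, 1, 4, 3, 2, 5, 7] = {1..7 + 2::nat}" by code_simp
  have low: "inj_at (\<lambda>_. 1 :: 'k) (tadpole_edges 7 2) {1..7 + 2} j" if "j \<le> 1" for j
    by (rule tadpole_inj_at_check[OF _ check]) (use that in simp_all)
  show "inj_at (\<lambda>_. 1 :: 'k) (tadpole_edges 7 2) {1..7 + 2} j" if "j \<le> 2" for j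
    using low[of j] top that by (cases "j = Suc 1") auto
  have check: "onto_check (tadpole_adj 7) [9, 4, 8, 7, 2, 1, 5, 6, 3] 4
      \<and> distinct [9, 4, 8, 7, 2, 1, 5, 6, 3::nat]
      \<and> set [9, 4, 8, 7, 2, 1, 5, 6, 3] = {1..7 + 2::nat}" by code_simp
  show "onto_at (\<lambda>_. 1 :: 'k) (tadpole_edges 7 2) {1..7 + 2} k" if "k \<ge> 2 + 2" for k
    by (rule tadpole_onto_at_check[OF _ check]) (use that in simp_all)
qed simp

lemma WLP_tadpole_8: "AG_has_WLP TYPE('k::field_char_0) (8 + 2) (tadpole_edges 8 2)"
proof (rule WLP_tadpole[where d = 2])
  have check: "inj_check (tadpole_adj 8) [8, 2, 9, 4, 6, 3, 1, 10, 7, 5] 2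
      \<and> distinct [8, 2, 9, 4, 6, 3, 1, 10, 7, 5::nat]
      \<and> set [8, 2, 9, 4, 6, 3, 1, 10, 7, 5] = {1..8 + 2::nat}" by code_simp
  show "inj_at (\<lambda>_. 1 :: 'k) (tadpole_edges 8 2) {1..8 + 2} j" if "j \<le> 2" for j
    by (rule tadpole_inj_at_check[OF _ check]) (use that in simp_all)
  have check: "onto_check (tadpole_adj 8) [9, 8, 3, 6, 1, 5, 7, 2, 10, 4] 4
      \<and> distinct [9, 8, 3, 6, 1, 5, 7, 2, 10, 4::nat]
      \<and> set [9, 8, 3, 6, 1, 5, 7, 2, 10, 4] = {1..8 + 2::nat}" by code_simp
  show "onto_at (\<lambda>_. 1 :: 'k) (tadpole_edges 8 2) {1..8 + 2} k" if "k \<ge> 2 + 2" for k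
    by (rule tadpole_onto_at_check[OF _ check]) (use that in simp_all)
qed simp

lemma WLP_tadpole_11: "AG_has_WLP TYPE('k::field_char_0) (11 + 2) (tadpole_edges 11 2)"
proof (rule WLP_tadpole[where d = 3])
  have check: "inj_check (tadpole_adj 11) [7, 6, 2, 9, 4, 10, 8, 5, 3, 1] 2
      \<and> distinct [7, 6, 2, 9, 4, 10, 8, 5, 3, 1::nat]
      \<and> set [7, 6, 2, 9, 4, 10, 8, 5, 3, 1] = {1..11 - 1::nat}" by code_simp
  have path: "inj_at (\<lambda>_. 1 :: 'k) (tadpole_edges 11 2) {1..11 - 1} 2"
    by (rule tadpole_inj_at_check[OF _ check]) simp_all
  \<comment> \<open>Here degree 3 comes from the square on the 11-cycle in degree 2 and from the
    path 1, ..., 10.\<close>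
  have top: "inj_at (\<lambda>_. 1 :: 'k) (tadpole_edges 11 2) {1..11 + 2} (Suc 2)"
    by (rule tadpole_inj_at_if_square_inj_at_cycle[OF _ _ path]) (simp_all add: square_inj_at_cycle_11[simplified])
  have check: "inj_check (tadpole_adj 11) [11, 10, 5, 8, 3, 12, 6, 2, 7, 4, 1, 13, 9] 2
      \<and> distinct [11, 10, 5, 8, 3, 12, 6, 2, 7, 4, 1, 13, 9::nat]
      \<and> set [11, 10, 5, 8, 3, 12, 6, 2, 7, 4, 1, 13, 9] = {1..11 + 2::nat}" by code_simp
  have low: "inj_at (\<lambda>_. 1 :: 'k) (tadpole_edges 11 2) {1..11 + 2} j" if "j \<le> 2" for j
    by (rule tadpole_inj_at_check[OF _ check]) (use that in simp_all)
  show "inj_at (\<lambda>_. 1 :: 'k) (tadpole_edges 11 2) {1..11 + 2} j" if "j \<le> 3" for j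
    using low[of j] top that by (cases "j = Suc 2") auto
  have check: "onto_check (tadpole_adj 11) [5, 6, 2, 12, 9, 11, 7, 3, 1, 8, 13, 4, 10] 5
      \<and> distinct [5, 6, 2, 12, 9, 11, 7, 3, 1, 8, 13, 4, 10::nat]
      \<and> set [5, 6, 2, 12, 9, 11, 7, 3, 1, 8, 13, 4, 10] = {1..11 + 2::nat}" by code_simp
  show "onto_at (\<lambda>_. 1 :: 'k) (tadpole_edges 11 2) {1..11 + 2} k" if "k \<ge> 3 + 2" for k
    by (rule tadpole_onto_at_check[OF _ check]) (use that in simp_all)
qed simp

theorem theorem4p1:
  fixes m :: nat
  assumes "m \<ge> 3"
  shows "AG_has_WLP TYPE('k::field_char_0) (m + 2) (tadpole_edges m 2) \<longleftrightarrow> m \<in> {4, 5, 7, 8, 11}"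
proof
  assume "AG_has_WLP TYPE('k) (m + 2) (tadpole_edges m 2)"
  then show "m \<in> {4, 5, 7, 8, 11}" using not_WLP_tadpole[OF assms] by blast
next
  assume "m \<in> {4, 5, 7, 8, 11}"
  then show "AG_has_WLP TYPE('k) (m + 2) (tadpole_edges m 2)"
    using WLP_tadpole_4 WLP_tadpole_5 WLP_tadpole_7 WLP_tadpole_8 WLP_tadpole_11 by blast
qed

end
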